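(* Let $T$ be a tree on $n$ vertices. The partial Petrial polynomial $P_T^\times(z)$ is trinomial (that is, has exactly three nonzero terms) if and only if $T$ is a T-shape tree or an H-shape tree.
   Context: All graphs are finite, simple and undirected. For a graph $G=(V,E)$ with $V=\{v_1,\dots,v_n\}$ and a subset $L\subseteq V$, let $\mathbf{A}_{(G,L)}=(a_{ij})$ be the $n\times n$ matrix over $\mathrm{GF}(2)$ with $a_{ij}=1$ if $i\neq j$ and $v_iv_j\in E$, $a_{ii}=1$ if $v_i\in L$, and all other entries $0$. Its corank is $\operatorname{corank}(\mathbf{A}_{(G,L)})=n-\operatorname{rank}(\mathbf{A}_{(G,L)})$, the rank being taken over $\mathrm{GF}(2)$. The partial Petrial polynomial of $G$ is the integer polynomial $$P_G^\times(z)=\sum_{L\subseteq V} z^{\,n-\operatorname{corank}(\mathbf{A}_{(G,L)})}.$$ The length of a path is its number of edges. For positive integers $a,b,c$, the T-shape tree $T(a,b,c)$ is obtained by attaching three pendant paths of lengths $a,b,c$ to a central vertex (so it has $a+b+c+1$ vertices, maximum degree $3$, and exactly one vertex of degree $3$). For positive integers $a,b,c,d$, the H-shape tree $H(a,b,c,d)$ consists of two adjacent vertices of degree $3$, one incident with two pendant paths of lengths $a$ and $b$, and the other with two pendant paths of lengths $c$ and $d$ (so it has $a+b+c+d+2$ vertices, maximum degree $3$, and exactly two vertices of degree $3$, which are adjacent). A T-shape tree (H-shape tree) is any graph isomorphic to some $T(a,b,c)$ (some $H(a,b,c,d)$). *)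

theory Defs
  imports
    "Graph_Theory.Graph_Theory"
    "Jordan_Normal_Form.DL_Rank"
    "HOL-Library.Z2"
    "HOL-Computational_Algebra.Polynomial"
begin

text \<open>
  Finite simple undirected graphs are the structures satisfying \<^locale>\<open>pair_graph\<close>: every
  undirected edge is represented by its two opposite arcs.  The type \<^typ>\<open>bit\<close> is the field GF(2).
\<close>

text \<open>
  The predicate \<^const>\<open>tree\<close> of the library is not usable for symmetric digraphs, since there each
  edge, traversed back and forth, is a \<^const>\<open>pre_digraph.cycle\<close> of length 2.  In a graph without
  loops and multiple edges, the cycles in the undirected sense are those of length at least 3.
  Connectedness includes that there is at least one vertex.
\<close>

definition undirected_tree :: "'a pair_pre_digraph \<Rightarrow> bool" where
  "undirected_tree G \<longleftrightarrow>
     pair_graph G \<and> Digraph_Component.connected (with_proj G) \<and>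
     \<not> (\<exists>p. pre_digraph.cycle (with_proj G) p \<and> length p \<ge> 3)"

text \<open>
  The vertices of \<open>G\<close> are enumerated as \<open>v 0, \<dots>, v (n - 1)\<close>, where \<open>n\<close> is their number.
  The definitions are meaningful if \<open>v\<close> is a bijection from \<open>{..<n}\<close> to the vertex set.
\<close>

definition loop_adj_mat :: "'a pair_pre_digraph \<Rightarrow> (nat \<Rightarrow> 'a) \<Rightarrow> 'a set \<Rightarrow> bit mat" where
  "loop_adj_mat G v L =
     mat (card (pverts G)) (card (pverts G))
       (\<lambda>(i, j). if i \<noteq> j \<and> (v i, v j) \<in> parcs G \<or> i = j \<and> v i \<in> L then 1 else 0)"

definition corank :: "nat \<Rightarrow> bit mat \<Rightarrow> nat" where
  "corank n A = n - vec_space.rank n A"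

definition partial_petrial_poly :: "'a pair_pre_digraph \<Rightarrow> (nat \<Rightarrow> 'a) \<Rightarrow> int poly" where
  "partial_petrial_poly G v =
     (let n = card (pverts G)
      in \<Sum>L\<in>Pow (pverts G). monom 1 (n - corank n (loop_adj_mat G v L)))"

definition trinomial :: "int poly \<Rightarrow> bool" where
  "trinomial p \<longleftrightarrow> card {k. coeff p k \<noteq> 0} = 3"

text \<open>
  The edges, oriented away from \<open>r\<close>, of the path \<open>r, (i, 1), \<dots>, (i, l)\<close> of length \<open>l\<close>; attaching
  it to \<open>r\<close> gives a pendant path.
\<close>

definition arm :: "nat \<times> nat \<Rightarrow> nat \<Rightarrow> nat \<Rightarrow> (nat \<times> nat) rel" where
  "arm r i l = {(if j = 0 then r else (i, j), (i, Suc j)) | j. j < l}"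

definition T_tree :: "nat \<Rightarrow> nat \<Rightarrow> nat \<Rightarrow> (nat \<times> nat) pair_pre_digraph" where
  "T_tree a b c =
     (let E = arm (0, 0) 1 a \<union> arm (0, 0) 2 b \<union> arm (0, 0) 3 c
      in \<lparr> pverts = {(0, 0)} \<union> {1} \<times> {1..a} \<union> {2} \<times> {1..b} \<union> {3} \<times> {1..c},
           parcs = E \<union> E\<inverse> \<rparr>)"

definition H_tree :: "nat \<Rightarrow> nat \<Rightarrow> nat \<Rightarrow> nat \<Rightarrow> (nat \<times> nat) pair_pre_digraph" where
  "H_tree a b c d =
     (let E = {((0, 0), (0, 1))} \<union> arm (0, 0) 1 a \<union> arm (0, 0) 2 b
              \<union> arm (0, 1) 3 c \<union> arm (0, 1) 4 d
      in \<lparr> pverts = {(0, 0), (0, 1)} \<union> {1} \<times> {1..a} \<union> {2} \<times> {1..b}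
                    \<union> {3} \<times> {1..c} \<union> {4} \<times> {1..d},
           parcs = E \<union> E\<inverse> \<rparr>)"

definition T_shape_tree :: "'a pair_pre_digraph \<Rightarrow> bool" where
  "T_shape_tree G \<longleftrightarrow>
     (\<exists>a b c. a > 0 \<and> b > 0 \<and> c > 0 \<and> digraph_iso (with_proj G) (with_proj (T_tree a b c)))"

definition H_shape_tree :: "'a pair_pre_digraph \<Rightarrow> bool" where
  "H_shape_tree G \<longleftrightarrow>
     (\<exists>a b c d. a > 0 \<and> b > 0 \<and> c > 0 \<and> d > 0 \<and>
        digraph_iso (with_proj G) (with_proj (H_tree a b c d)))"

end

theory Submission
  imports Defs
begin

text \<open>
  Write \<open>c(L)\<close> for the corank of \<open>A\<close>, the adjacency matrix of \<open>T\<close> over GF(2) with loops at \<open>L\<close>.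
  All coefficients of the polynomial are nonnegative, so its terms correspond to the values of
  \<open>c\<close>. These values form an interval \<open>{0..m}\<close>. The value 0 occurs, because a nonsingular principal
  submatrix stays nonsingular when it is bordered by a further vertex, for at least one of the two
  diagonal entries there (\<open>ex_trivial_null_space\<close>). No value is skipped, because adding or removing
  a single loop changes the corank by at most 1. So the polynomial is trinomial iff the largest corank \<open>m\<close> is 2, which is
  \<open>trinomial_iff_null_vectors\<close>. There, as in the whole development, the corank is measured by the
  number \<open>2 ^ c(L)\<close> of null vectors; over a finite field this turns all dimension arguments into
  counting fibres of additive maps (\<open>card_le_fibres\<close>).

  Large coranks come from deleting vertices (\<open>ex_large_null_space\<close>). If \<open>T - S\<close> has \<open>k\<close> components,
  choose the loops so that on each component the matrix is the Laplacian modulo 2. The \<open>k\<close> indicator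
  vectors of the components then solve all equations outside \<open>S\<close>, and the equations at \<open>S\<close> cut
  the dimension down by at most \<open>|S|\<close>. In a tree, deleting one vertex of degree \<open>d\<close> thus yields a
  corank of at least \<open>d - 1\<close>, and deleting two nonadjacent vertices of degree at least 3 yields at
  least \<open>5 - 2 = 3\<close>. Hence \<open>m = 2\<close> forces all degrees to be at most 3 and any two vertices of
  degree 3 to be adjacent. As a tree has no triangles, there are at most two of them. If there is
  none, the tree is a path, and \<open>m \<le> 1\<close>; with one, it is a T-shape tree; with two, it is an
  H-shape tree.

  Conversely, a vertex of degree 3 gives \<open>m \<ge> 2\<close>. For \<open>m \<le> 2\<close> it is enough to find two vertices such
  that a null vector that vanishes there vanishes everywhere. Two ends of pendant paths do, one at
  each vertex of degree 3 in the case of an H-shape tree: the equation at the end of a path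
  forces the next entry to be zero, and so on up to the branching vertex, from where zeros
  propagate outwards along the remaining pendant path.

  The shape of a tree is recorded by lists of vertices, one for each path from which the graph is
  glued together. The lists are obtained by extending walks that never turn back; in a tree, such
  walks do not repeat a vertex (\<open>non_backtracking_distinct\<close>).
\<close>

section \<open>Counting over GF(2)\<close>

text \<open>
  These rules replace field operations by bit operations, which hides sums and products from the
  lemmas on rings.
\<close>

declare add_bit_eq_xor [simp del] mult_bit_eq_and [simp del]

lemma bit_add_eq_0_iff: "a + b = 0 \<longleftrightarrow> a = b" for a b :: bit
  by (cases a; cases b) simp_all

lemma bit_add_self: "a + a = 0" for a :: bit
  by (cases a) simp_all

lemma UNIV_bit: "(UNIV :: bit set) = {0, 1}"
  by (auto intro: bit.exhaust)

lemma card_bit_functions: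
  assumes "finite S"
  shows "card {x :: 'b \<Rightarrow> bit. \<forall>u. u \<notin> S \<longrightarrow> x u = 0} = 2 ^ card S"
    and "finite {x :: 'b \<Rightarrow> bit. \<forall>u. u \<notin> S \<longrightarrow> x u = 0}"
proof -
  have *: "bij_betw (\<lambda>U u. if u \<in> U then 1 else 0 :: bit) (Pow S) {x. \<forall>u. u \<notin> S \<longrightarrow> x u = 0}"
    by (rule bij_betw_byWitness[where f' = "\<lambda>x. {u. x u = 1}"]) (auto simp: fun_eq_iff)
  show "card {x :: 'b \<Rightarrow> bit. \<forall>u. u \<notin> S \<longrightarrow> x u = 0} = 2 ^ card S"
    using bij_betw_same_card[OF *] assms by (simp add: card_Pow)
  show "finite {x :: 'b \<Rightarrow> bit. \<forall>u. u \<notin> S \<longrightarrow> x u = 0}"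
    using bij_betw_finite[OF *] assms by simp
qed

lemma card_span_bit:
  fixes B :: "bit vec set"
  assumes "finite B" "B \<subseteq> carrier_vec n"
    and indep: "module.lin_indpt class_ring (module_vec TYPE(bit) n) B"
  shows "card (LinearCombinations.module.span class_ring (module_vec TYPE(bit) n) B) = 2 ^ card B"
proof -
  interpret vec_space "TYPE(bit)" n .
  let ?C = "{x :: bit vec \<Rightarrow> bit. \<forall>u. u \<notin> B \<longrightarrow> x u = 0}"
  have "span B = (\<lambda>a. lincomb a B) ` ?C"
  proof
    show "span B \<subseteq> (\<lambda>a. lincomb a B) ` ?C"
    proof
      fix y assume "y \<in> span B"
      then obtain a where a: "lincomb a B = y"
        using finite_in_span[of B y] assms by auto
      have "lincomb (\<lambda>u. if u \<in> B then a u else 0) B = lincomb a B"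
        using assms(2) by (intro lincomb_cong) (auto simp: module_vec_simps)
      then show "y \<in> (\<lambda>a. lincomb a B) ` ?C"
        using a by (intro image_eqI[of _ _ "\<lambda>u. if u \<in> B then a u else 0"]) auto
    qed
    show "(\<lambda>a. lincomb a B) ` ?C \<subseteq> span B"
      using finite_span[OF assms(1)] assms(2) by (auto simp: class_ring_simps)
  qed
  moreover have "inj_on (\<lambda>a. lincomb a B) ?C"
  proof (rule inj_onI)
    fix a b assume ab: "a \<in> ?C" "b \<in> ?C" "lincomb a B = lincomb b B"
    have "lincomb (\<lambda>v. a v + b v) B = 0\<^sub>v n"
    proof (rule eq_vecI)
      show "dim_vec (lincomb (\<lambda>v. a v + b v) B) = dim_vec (0\<^sub>v n :: bit vec)"
        using lincomb_dim assms by simp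
      fix i assume "i < dim_vec (0\<^sub>v n :: bit vec)"
      then have i: "i < n" by simp
      have "lincomb (\<lambda>v. a v + b v) B $ i = lincomb a B $ i + lincomb b B $ i"
        using i assms(2) by (simp add: lincomb_index distrib_right sum.distrib)
      also have "\<dots> = 0" using ab(3) by simp
      finally show "lincomb (\<lambda>v. a v + b v) B $ i = 0\<^sub>v n $ i" using i by simp
    qed
    then have "a v + b v = 0" if "v \<in> B" for v
      using lin_dep_crit[where A = B and S = B and a = "\<lambda>v. a v + b v" and v = v] that assms
      by (cases "a v + b v") (auto simp: class_ring_simps)
    then have "a v = b v" for v
      using ab(1,2) by (cases "v \<in> B") (auto simp: bit_add_eq_0_iff)
    then show "a = b" by blast
  qed
  ultimately show ?thesis
    using card_bit_functions(1)[OF assms(1)]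
    by (simp only: card_image)
qed

text \<open>
  The image of the matrix is its column space, and a basis of it has as many elements as the rank.
\<close>

lemma card_image_mat_bit:
  fixes A :: "bit mat"
  assumes A: "A \<in> carrier_mat n nc"
  shows "card ((\<lambda>x. A *\<^sub>v x) ` carrier_vec nc) = 2 ^ vec_space.rank n A"
proof -
  interpret vec_space "TYPE(bit)" n .
  let ?W = "span (set (cols A))"
  have cols: "set (cols A) \<subseteq> carrier_vec n" using cols_dim A by blast
  interpret W: vectorspace class_ring "span_vs (set (cols A))"
    using cols by (intro subspace_is_vs span_is_subspace) simp
  have sub: "LinearCombinations.submodule class_ring ?W V"
    using cols by (simp add: span_is_submodule)
  have "W.fin_dim"
    unfolding W.fin_dim_def
    using cols in_own_span[of "set (cols A)"] span_li_not_depend(1)[OF _ sub, of "set (cols A)"]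
    by (intro exI[of _ "set (cols A)"]) auto
  then obtain B where B: "finite B" "W.basis B" using W.finite_basis_exists by blast
  then have BW: "B \<subseteq> ?W" and "W.lin_indpt B" "W.gen_set B"
    unfolding W.basis_def by auto
  then have BI: "lin_indpt B" and "span B = ?W"
    using span_li_not_depend[OF BW sub] by auto
  moreover have BC: "B \<subseteq> carrier_vec n" using BW span_closed[of "set (cols A)"] cols by auto
  moreover have "rank A = card B" unfolding rank_def using W.dim_basis[OF B] .
  moreover have "?W = (\<lambda>x. A *\<^sub>v x) ` carrier_vec nc"
    using col_space_eq[OF A] A unfolding col_space_def by auto
  ultimately show ?thesis using card_span_bit[OF B(1) BC BI] by (simp only:)
qed

text \<open>
  Rank-nullity in multiplicative form: all fibres of the matrix over its image are translates of
  the kernel.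
\<close>

lemma card_kernel_mat_bit:
  fixes A :: "bit mat"
  assumes A: "A \<in> carrier_mat n nc"
  shows "card {x \<in> carrier_vec nc. A *\<^sub>v x = 0\<^sub>v n} * 2 ^ vec_space.rank n A = 2 ^ nc"
proof -
  let ?K = "{x \<in> carrier_vec nc. A *\<^sub>v x = 0\<^sub>v n}"
  let ?C = "{x :: nat \<Rightarrow> bit. \<forall>u. u \<notin> {..<nc} \<longrightarrow> x u = 0}"
  have bij: "bij_betw (vec nc) ?C (carrier_vec nc)"
    by (rule bij_betw_byWitness[where f' = "\<lambda>x i. if i < nc then x $ i else 0"])
       (auto simp: fun_eq_iff)
  have fin: "finite (carrier_vec nc :: bit vec set)" "card (carrier_vec nc :: bit vec set) = 2 ^ nc"
    using bij_betw_finite[OF bij] bij_betw_same_card[OF bij] card_bit_functions[of "{..<nc}"]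
    by auto
  have fibre: "card {x \<in> carrier_vec nc. A *\<^sub>v x = y} = card ?K"
    if y: "y \<in> (\<lambda>x. A *\<^sub>v x) ` carrier_vec nc" for y
  proof -
    obtain x0 where x0: "x0 \<in> carrier_vec nc" "y = A *\<^sub>v x0" using y by auto
    have Ax0: "A *\<^sub>v x0 \<in> carrier_vec n" using A x0(1) by (rule mult_mat_vec_carrier)
    have "bij_betw (\<lambda>x. x0 + x) ?K {x \<in> carrier_vec nc. A *\<^sub>v x = y}"
    proof (rule bij_betw_byWitness[where f' = "\<lambda>x. x - x0"])
      show "\<forall>x\<in>?K. x0 + x - x0 = x"
        using x0(1) by (auto intro!: eq_vecI)
      show "\<forall>x\<in>{x \<in> carrier_vec nc. A *\<^sub>v x = y}. x0 + (x - x0) = x"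
        using x0(1) by (auto intro!: eq_vecI)
      show "(+) x0 ` ?K \<subseteq> {x \<in> carrier_vec nc. A *\<^sub>v x = y}"
      proof clarify
        fix x assume "x \<in> carrier_vec nc" "A *\<^sub>v x = 0\<^sub>v n"
        then show "x0 + x \<in> carrier_vec nc \<and> A *\<^sub>v (x0 + x) = y"
          using mult_add_distrib_mat_vec[OF A x0(1), of x] x0 Ax0 by simp
      qed
      show "(\<lambda>x. x - x0) ` {x \<in> carrier_vec nc. A *\<^sub>v x = y} \<subseteq> ?K"
      proof clarify
        fix x assume "x \<in> carrier_vec nc" "y = A *\<^sub>v x"
        then show "x - x0 \<in> carrier_vec nc \<and> A *\<^sub>v (x - x0) = 0\<^sub>v n"
          using mult_minus_distrib_mat_vec[OF A _ x0(1), of x] x0 Ax0 by simp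
      qed
    qed
    from bij_betw_same_card[OF this] show ?thesis by (rule sym)
  qed
  have "2 ^ nc = card (carrier_vec nc :: bit vec set)" using fin by simp
  also have "\<dots> = (\<Sum>y\<in>(\<lambda>x. A *\<^sub>v x) ` carrier_vec nc. card {x \<in> carrier_vec nc. A *\<^sub>v x = y})"
    unfolding card_eq_sum by (rule sum.image_gen[OF fin(1)])
  also have "\<dots> = (\<Sum>y\<in>(\<lambda>x. A *\<^sub>v x) ` carrier_vec nc. card ?K)"
    by (rule sum.cong[OF refl fibre])
  also have "\<dots> = card ((\<lambda>x. A *\<^sub>v x) ` carrier_vec nc) * card ?K"
    by (simp only: sum_constant of_nat_id)
  finally show ?thesis using card_image_mat_bit[OF A] by (simp add: mult.commute)
qed

text \<open>
  A multiplicative substitute for dimension estimates: any two elements of a fibre of \<open>\<phi>\<close> differ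
  by an element of \<open>K\<close>, so no fibre has more elements than \<open>K\<close>. In characteristic 2, differences
  are sums.
\<close>

lemma card_le_fibres:
  fixes X K :: "('b \<Rightarrow> bit) set"
  assumes "finite K" "finite T" "\<phi> ` X \<subseteq> T"
    and diff: "\<And>x y. x \<in> X \<Longrightarrow> y \<in> X \<Longrightarrow> \<phi> x = \<phi> y \<Longrightarrow> (\<lambda>u. x u + y u) \<in> K"
  shows "card X \<le> card T * card K"
proof -
  define rep where "rep t = (SOME y. y \<in> X \<and> \<phi> y = t)" for t
  have rep: "rep (\<phi> x) \<in> X \<and> \<phi> (rep (\<phi> x)) = \<phi> x" if "x \<in> X" for x
    unfolding rep_def using that someI[of "\<lambda>y. y \<in> X \<and> \<phi> y = \<phi> x" x] by blast
  let ?h = "\<lambda>x. (\<phi> x, \<lambda>u. x u + rep (\<phi> x) u)"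
  have "inj_on ?h X"
  proof (rule inj_onI)
    fix x y assume "x \<in> X" "y \<in> X" and eq: "?h x = ?h y"
    then have "\<phi> x = \<phi> y" "(\<lambda>u. x u + rep (\<phi> x) u) = (\<lambda>u. y u + rep (\<phi> y) u)"
      by auto
    then have "x u + rep (\<phi> x) u = y u + rep (\<phi> x) u" for u
      by (simp add: fun_eq_iff)
    then show "x = y" by (intro ext) (simp only: add_right_cancel)
  qed
  moreover have "?h ` X \<subseteq> T \<times> K"
    using assms(3) rep diff by auto
  ultimately have "card X \<le> card (T \<times> K)"
    using assms by (intro card_inj_on_le[of ?h]) auto
  then show ?thesis by (simp add: card_cartesian_product)
qed

section \<open>Null vectors of a graph with loops\<close>

text \<open>
  The kernel of \<^const>\<open>loop_adj_mat\<close>, with entries indexed by vertices. The term of the loop stands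
  on the right-hand side of each equation, which is harmless over GF(2).
\<close>

definition null_vectors :: "'a pair_pre_digraph \<Rightarrow> 'a set \<Rightarrow> ('a \<Rightarrow> bit) set" where
  "null_vectors G L =
     {x. (\<forall>u. u \<notin> pverts G \<longrightarrow> x u = 0) \<and>
         (\<forall>w\<in>pverts G. (\<Sum>u\<in>parcs G `` {w}. x u) = (if w \<in> L then x w else 0))}"

lemma zero_in_null_vectors: "(\<lambda>_. 0) \<in> null_vectors G L"
  by (simp add: null_vectors_def)

lemma add_in_null_vectors:
  assumes "x \<in> null_vectors G L" "y \<in> null_vectors G L"
  shows "(\<lambda>u. x u + y u) \<in> null_vectors G L"
  using assms by (simp add: null_vectors_def sum.distrib)

context pair_graph
begin

lemma nbrs_finite [simp]: "finite (parcs G `` {w})"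
  using pair_finite_arcs by (rule finite_Image)

lemma not_self_nbr [simp]: "(w, w) \<notin> parcs G"
  using pair_no_loops by force

lemma nbrs_subset: "parcs G `` {w} \<subseteq> pverts G"
  by (auto dest: in_arcsD2)

lemma arc_sym: "(u, w) \<in> parcs G \<longleftrightarrow> (w, u) \<in> parcs G"
  using graph_symmetric by auto

lemma finite_null_vectors: "finite (null_vectors G L)"
  using card_bit_functions(2)[OF pair_finite_verts]
  by (rule rev_finite_subset) (auto simp: null_vectors_def)

lemma card_null_vectors_eq:
  assumes v: "bij_betw v {..<n} (pverts G)" and n: "card (pverts G) = n"
  shows "card (null_vectors G L) = 2 ^ corank n (loop_adj_mat G v L)"
    and "corank n (loop_adj_mat G v L) \<le> n"
proof -
  define A where "A = loop_adj_mat G v L"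
  have A: "A \<in> carrier_mat n n" by (simp add: A_def loop_adj_mat_def n)
  have entry: "(A *\<^sub>v vec n (\<lambda>j. x (v j))) $ i
      = (\<Sum>u\<in>parcs G `` {v i}. x u) + (if v i \<in> L then x (v i) else 0)" if i: "i < n" for i x
  proof -
    have vi: "v i \<in> pverts G" using bij_betwE[OF v] i by auto
    have "(A *\<^sub>v vec n (\<lambda>j. x (v j))) $ i
        = (\<Sum>j<n. (if i \<noteq> j \<and> (v i, v j) \<in> parcs G \<or> i = j \<and> v i \<in> L then 1 else 0) * x (v j))"
      using i by (auto simp: A_def loop_adj_mat_def n scalar_prod_def lessThan_atLeast0
          intro!: sum.cong)
    also have "\<dots> = (\<Sum>j<n. (if (v i, v j) \<in> parcs G then x (v j) else 0)
        + (if v j = v i then (if v i \<in> L then x (v i) else 0) else 0))"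
      using v i by (intro sum.cong) (auto simp: bij_betw_def inj_on_def)
    also have "\<dots> = (\<Sum>u\<in>pverts G. (if (v i, u) \<in> parcs G then x u else 0)
        + (if u = v i then (if v i \<in> L then x (v i) else 0) else 0))"
      by (rule sum.reindex_bij_betw[OF v])
    also have "\<dots> = (\<Sum>u\<in>pverts G. if (v i, u) \<in> parcs G then x u else 0)
        + (if v i \<in> L then x (v i) else 0)"
      using vi pair_finite_verts by (simp add: sum.distrib)
    also have "(\<Sum>u\<in>pverts G. if (v i, u) \<in> parcs G then x u else 0) = (\<Sum>u\<in>parcs G `` {v i}. x u)"
      using nbrs_subset[of "v i"] pair_finite_verts
      by (subst sum.inter_filter[symmetric]) (auto intro!: sum.cong)
    finally show ?thesis .
  qed
  have "bij_betw (\<lambda>x. vec n (\<lambda>j. x (v j))) (null_vectors G L) {y \<in> carrier_vec n. A *\<^sub>v y = 0\<^sub>v n}"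
  proof (rule bij_betw_byWitness[where
        f' = "\<lambda>y u. if u \<in> pverts G then y $ (the_inv_into {..<n} v u) else 0"], goal_cases)
    case 1
    show ?case
    proof (intro ballI ext)
      fix x u assume "x \<in> null_vectors G L"
      moreover have "the_inv_into {..<n} v u < n \<and> v (the_inv_into {..<n} v u) = u"
        if "u \<in> pverts G"
        using that v by (metis bij_betw_def f_the_inv_into_f lessThan_iff order_refl
            the_inv_into_into)
      ultimately show "(if u \<in> pverts G then vec n (\<lambda>j. x (v j)) $ the_inv_into {..<n} v u else 0) = x u"
        by (auto simp: null_vectors_def)
    qed
  next
    case 2
    have "the_inv_into {..<n} v (v i) = i \<and> v i \<in> pverts G" if "i < n" for i
      using that v by (auto simp: bij_betw_def the_inv_into_f_f)
    then show ?case by auto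
  next
    case 3
    show ?case
    proof clarify
      fix x assume x: "x \<in> null_vectors G L"
      have "A *\<^sub>v vec n (\<lambda>j. x (v j)) = 0\<^sub>v n"
      proof (rule eq_vecI)
        fix i assume "i < dim_vec (0\<^sub>v n :: bit vec)"
        then show "(A *\<^sub>v vec n (\<lambda>j. x (v j))) $ i = 0\<^sub>v n $ i"
          using x bij_betwE[OF v] by (auto simp: entry null_vectors_def bit_add_eq_0_iff)
      qed (use A in auto)
      then show "vec n (\<lambda>j. x (v j)) \<in> carrier_vec n \<and> A *\<^sub>v vec n (\<lambda>j. x (v j)) = 0\<^sub>v n"
        by simp
    qed
  next
    case 4
    show ?case
    proof clarify
      fix y :: "bit vec" assume y: "y \<in> carrier_vec n" "A *\<^sub>v y = 0\<^sub>v n"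
      let ?x = "\<lambda>u. if u \<in> pverts G then y $ (the_inv_into {..<n} v u) else 0"
      have inv: "the_inv_into {..<n} v (v i) = i \<and> v i \<in> pverts G" if "i < n" for i
        using that v by (auto simp: bij_betw_def the_inv_into_f_f)
      have yx: "y = vec n (\<lambda>j. ?x (v j))" using y inv by auto
      have "(\<Sum>u\<in>parcs G `` {w}. ?x u) = (if w \<in> L then ?x w else 0)" if "w \<in> pverts G" for w
      proof -
        obtain i where i: "i < n" "w = v i" using \<open>w \<in> pverts G\<close> v by (auto simp: bij_betw_def)
        have "(\<Sum>u\<in>parcs G `` {v i}. ?x u) + (if v i \<in> L then ?x (v i) else 0) = 0"
          using entry[OF i(1), of ?x] y(2) i(1) yx by (metis index_zero_vec(1))
        then show ?thesis using i by (simp only: bit_add_eq_0_iff)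
      qed
      then show "?x \<in> null_vectors G L" unfolding null_vectors_def by simp
    qed
  qed
  from bij_betw_same_card[OF this]
  have "card (null_vectors G L) * 2 ^ vec_space.rank n A = 2 ^ n"
    using card_kernel_mat_bit[OF A] by (simp only:)
  moreover have "vec_space.rank n A \<le> n" using vec_space.rank_le_nc[OF A] .
  then have "(2::nat) ^ n = 2 ^ corank n A * 2 ^ vec_space.rank n A"
    by (simp add: corank_def flip: power_add)
  ultimately show "card (null_vectors G L) = 2 ^ corank n (loop_adj_mat G v L)"
    by (simp add: A_def)
  show "corank n (loop_adj_mat G v L) \<le> n" by (simp add: corank_def)
qed

text \<open>
  The null vectors that vanish at \<open>w\<close> do not depend on whether there is a loop at \<open>w\<close>, and they have
  index at most 2 among all null vectors.
\<close>

lemma card_null_vectors_step: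
  assumes "L - {w} = L' - {w}"
  shows "card (null_vectors G L) \<le> 2 * card (null_vectors G L')"
proof -
  have "card (null_vectors G L) \<le> card (UNIV :: bit set) * card (null_vectors G L')"
  proof (rule card_le_fibres[where \<phi> = "\<lambda>x. x w"])
    fix x y assume xy: "x \<in> null_vectors G L" "y \<in> null_vectors G L" "x w = y w"
    have "u = w \<or> (u \<in> L \<longleftrightarrow> u \<in> L')" for u using assms by blast
    moreover have "x w + y w = 0" using xy(3) by (simp add: bit_add_eq_0_iff)
    ultimately have "(if u \<in> L then x u + y u else 0) = (if u \<in> L' then x u + y u else 0)" for u
      by metis
    then show "(\<lambda>u. x u + y u) \<in> null_vectors G L'"
      using add_in_null_vectors[OF xy(1,2)] by (simp add: null_vectors_def)
  qed (auto simp: UNIV_bit finite_null_vectors)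
  then show ?thesis by (simp add: UNIV_bit)
qed

text \<open>
  Vertices are added one at a time, keeping the null space of the induced subgraph trivial. When
  \<open>z\<close> is added, any nonzero null vector has entry 1 at \<open>z\<close>, and it is determined by that, since
  two of them differ by a null vector of the smaller graph. This one candidate cannot satisfy
  the equation at \<open>z\<close> both with and without a loop there.
\<close>

lemma ex_trivial_null_space: "\<exists>L\<subseteq>pverts G. card (null_vectors G L) = 1"
proof -
  let ?N = "\<lambda>W L x. (\<forall>u. u \<notin> W \<longrightarrow> x u = 0) \<and>
    (\<forall>w\<in>W. (\<Sum>u\<in>parcs G `` {w}. x u) = (if w \<in> L then x w else (0::bit)))"
  have main: "\<exists>L\<subseteq>W. \<forall>x. ?N W L x \<longrightarrow> x = (\<lambda>_. 0)" if "finite W" for W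
    using that
  proof (induction W)
    case empty
    then show ?case by auto
  next
    case (insert z W)
    then obtain L where L: "L \<subseteq> W" and triv: "\<And>x. ?N W L x \<Longrightarrow> x = (\<lambda>_. 0)" by blast
    have z: "x z = 1" if "?N (insert z W) L' x" "L' \<subseteq> insert z L" "L \<subseteq> L'" "x \<noteq> (\<lambda>_. 0)" for L' x
    proof (rule ccontr)
      assume "x z \<noteq> 1"
      then have "?N W L x" using that insert.hyps(2) L by auto
      then show False using triv that(4) by blast
    qed
    show ?case
    proof (rule ccontr)
      assume contr: "\<not> ?thesis"
      obtain x where x: "?N (insert z W) L x" "x \<noteq> (\<lambda>_. 0)"
        using contr L by blast
      obtain y where y: "?N (insert z W) (insert z L) y" "y \<noteq> (\<lambda>_. 0)"
        using contr L by (metis insert_mono)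
      have xz: "x z = 1" "y z = 1" using z[OF x(1)] x(2) z[OF y(1)] y(2) by auto
      have "x u + y u = 0" if "u \<notin> W" for u
        using x(1) y(1) xz that by (cases "u = z") (auto simp: bit_add_self)
      then have "?N W L (\<lambda>u. x u + y u)"
        using x(1) y(1) xz insert.hyps(2) by (auto simp: sum.distrib bit_add_self)
      then have "(\<lambda>u. x u + y u) = (\<lambda>_. 0)" by (rule triv)
      then have "x = y" by (metis bit_add_eq_0_iff ext)
      moreover have "z \<notin> L" using L insert.hyps(2) by auto
      ultimately show False using x(1) y(1) xz by auto
    qed
  qed
  obtain L where L: "L \<subseteq> pverts G" "\<forall>x. ?N (pverts G) L x \<longrightarrow> x = (\<lambda>_. 0)"
    using main[OF pair_finite_verts] by (elim exE conjE)
  then have "null_vectors G L \<subseteq> {\<lambda>_. 0}" unfolding null_vectors_def by blast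
  then have "null_vectors G L = {\<lambda>_. 0}" using zero_in_null_vectors by blast
  then have "card (null_vectors G L) = 1" by (simp only: card.insert finite.emptyI card.empty) simp
  then show ?thesis using L(1) by blast
qed

text \<open>
  A discrete intermediate value argument: among the loop sets with at most \<open>2 ^ k\<close> null vectors, take
  one closest to \<open>L1\<close>. If it had fewer than \<open>2 ^ k\<close>, one more step towards \<open>L1\<close> would still be
  allowed.
\<close>

lemma ex_intermediate_null_space:
  assumes "2 ^ k \<le> card (null_vectors G L1)" "L1 \<subseteq> pverts G"
    and pow: "\<And>L. \<exists>c. card (null_vectors G L) = 2 ^ c"
  shows "\<exists>L\<subseteq>pverts G. card (null_vectors G L) = 2 ^ k"
proof -
  let ?d = "\<lambda>L. card ((L - L1) \<union> (L1 - L))"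
  let ?P = "\<lambda>L. L \<subseteq> pverts G \<and> card (null_vectors G L) \<le> 2 ^ k"
  obtain L0 where "L0 \<subseteq> pverts G" "card (null_vectors G L0) = 1"
    using ex_trivial_null_space by blast
  then have L0: "?P L0" by simp
  define L where "L = arg_min ?d ?P"
  have L: "?P L" and min: "\<And>L'. ?P L' \<Longrightarrow> ?d L \<le> ?d L'"
    unfolding L_def using arg_min_nat_lemma[of ?P L0 ?d, OF L0] by blast+
  have "card (null_vectors G L) = 2 ^ k"
  proof (rule ccontr)
    assume "card (null_vectors G L) \<noteq> 2 ^ k"
    then have lt: "card (null_vectors G L) < 2 ^ k" using L by simp
    then have "L \<noteq> L1" using assms(1) by auto
    then obtain w where w: "w \<in> (L - L1) \<union> (L1 - L)" by blast
    define L' where "L' = (if w \<in> L then L - {w} else insert w L)"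
    have sub: "L' \<subseteq> pverts G" using L w assms(2) by (auto simp: L'_def)
    obtain c where c: "card (null_vectors G L) = 2 ^ c" using pow by blast
    then have "2 ^ Suc c \<le> (2::nat) ^ k" using lt by (intro power_increasing) auto
    moreover have "card (null_vectors G L') \<le> 2 * card (null_vectors G L)"
      by (rule card_null_vectors_step[of _ w]) (auto simp: L'_def)
    ultimately have "?P L'" using sub c by simp
    moreover have "(L' - L1) \<union> (L1 - L') \<subset> (L - L1) \<union> (L1 - L)"
      using w by (auto simp: L'_def)
    moreover have "finite ((L - L1) \<union> (L1 - L))"
      using L assms(2) finite_subset[OF _ pair_finite_verts] by auto
    ultimately show False using min[of L'] psubset_card_mono by (metis leD)
  qed
  then show ?thesis using L by blast
qed

text \<open>
  The coranks form an initial segment \<open>{..m}\<close> of the natural numbers, so there are exactly three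
  of them iff \<open>m = 2\<close>.
\<close>

lemma trinomial_iff_null_vectors:
  assumes v: "bij_betw v {..<n} (pverts G)" and n: "card (pverts G) = n"
  shows "trinomial (partial_petrial_poly G v) \<longleftrightarrow>
    (\<forall>L\<subseteq>pverts G. card (null_vectors G L) \<le> 4) \<and> (\<exists>L\<subseteq>pverts G. 4 \<le> card (null_vectors G L))"
proof -
  define c where "c L = corank n (loop_adj_mat G v L)" for L
  have card_eq: "card (null_vectors G L) = 2 ^ c L" and c_le: "c L \<le> n" for L
    unfolding c_def by (rule card_null_vectors_eq[OF v n])+
  let ?C = "c ` Pow (pverts G)"
  have fin: "finite (Pow (pverts G))" using pair_finite_verts by simp
  have "coeff (partial_petrial_poly G v) k = int (card {L \<in> Pow (pverts G). n - c L = k})" for k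
    using fin by (simp add: partial_petrial_poly_def Let_def n coeff_sum c_def
        flip: sum.inter_filter)
  then have "{k. coeff (partial_petrial_poly G v) k \<noteq> 0} = (\<lambda>c. n - c) ` ?C"
    using fin by (auto simp: card_eq_0_iff)
  moreover have "inj_on (\<lambda>c. n - c) ?C"
    using c_le by (auto intro!: inj_onI) (metis diff_diff_cancel)
  ultimately have tri: "trinomial (partial_petrial_poly G v) \<longleftrightarrow> card ?C = 3"
    by (simp add: trinomial_def card_image)
  have down: "k \<in> ?C" if m: "m \<in> ?C" and "k \<le> m" for k m
  proof -
    obtain L1 where "L1 \<subseteq> pverts G" "c L1 = m" using m by auto
    then have "\<exists>L\<subseteq>pverts G. card (null_vectors G L) = 2 ^ k"
      using \<open>k \<le> m\<close> by (intro ex_intermediate_null_space[of k L1]) (auto simp: card_eq)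
    then show ?thesis by (auto simp: card_eq)
  qed
  define m where "m = Max ?C"
  have mC: "m \<in> ?C" unfolding m_def using fin by (intro Max_in) auto
  have max: "c L \<le> m" if "L \<subseteq> pverts G" for L
    unfolding m_def using that fin by (intro Max_ge) auto
  have "?C = {..m}" using max down[OF mC] by blast
  have le4: "card (null_vectors G L) \<le> 4 \<longleftrightarrow> c L \<le> 2" for L
    using power_increasing_iff[of "2::nat" "c L" 2] by (simp add: card_eq)
  have ge4: "4 \<le> card (null_vectors G L) \<longleftrightarrow> 2 \<le> c L" for L
    using power_increasing_iff[of "2::nat" 2 "c L"] by (simp add: card_eq)
  have "card ?C = 3 \<longleftrightarrow> m = 2" using \<open>?C = {..m}\<close> by auto
  also have "\<dots> \<longleftrightarrow> (\<forall>L\<subseteq>pverts G. c L \<le> 2) \<and> (\<exists>L\<subseteq>pverts G. 2 \<le> c L)"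
  proof
    assume "m = 2"
    then show "(\<forall>L\<subseteq>pverts G. c L \<le> 2) \<and> (\<exists>L\<subseteq>pverts G. 2 \<le> c L)"
      using max mC by auto
  next
    assume *: "(\<forall>L\<subseteq>pverts G. c L \<le> 2) \<and> (\<exists>L\<subseteq>pverts G. 2 \<le> c L)"
    then obtain L where "L \<subseteq> pverts G" "2 \<le> c L" by blast
    then have "2 \<le> m" using max[of L] by simp
    moreover have "m \<le> 2" using * mC by auto
    ultimately show "m = 2" by simp
  qed
  finally show ?thesis using tri by (simp add: le4 ge4)
qed

end

section \<open>Walks without backtracking\<close>

fun non_backtracking :: "'a rel \<Rightarrow> 'a list \<Rightarrow> bool" where
  "non_backtracking E [] \<longleftrightarrow> True"
| "non_backtracking E [x] \<longleftrightarrow> True"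
| "non_backtracking E [x, y] \<longleftrightarrow> (x, y) \<in> E"
| "non_backtracking E (x # y # z # zs) \<longleftrightarrow>
     (x, y) \<in> E \<and> x \<noteq> z \<and> non_backtracking E (y # z # zs)"

lemma non_backtracking_successively:
  "non_backtracking E xs \<Longrightarrow> successively (\<lambda>u w. (u, w) \<in> E) xs"
  by (induction E xs rule: non_backtracking.induct) auto

lemma non_backtracking_arcs:
  "non_backtracking E xs \<Longrightarrow> set (vwalk_arcs xs) \<subseteq> E"
  by (induction E xs rule: non_backtracking.induct) auto

lemma non_backtracking_tl: "non_backtracking E (x # xs) \<Longrightarrow> non_backtracking E xs"
  by (cases "(E, x # xs)" rule: non_backtracking.cases) auto

text \<open>
  An overlap of two vertices is needed, as the condition concerns three consecutive vertices.
\<close>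

lemma non_backtracking_glue:
  "non_backtracking E (xs @ [a, b]) \<Longrightarrow> non_backtracking E (a # b # ys) \<Longrightarrow>
   non_backtracking E (xs @ a # b # ys)"
proof (induction xs)
  case (Cons x xs)
  then have "non_backtracking E (xs @ a # b # ys)" using non_backtracking_tl by fastforce
  then show ?case using Cons.prems
    by (cases xs; cases "tl xs") auto
qed simp

lemma non_backtracking_rev:
  "sym E \<Longrightarrow> non_backtracking E xs \<Longrightarrow> non_backtracking E (rev xs)"
proof (induction E xs rule: non_backtracking.induct)
  case (3 E x y)
  then show ?case by (auto dest: symD)
next
  case (4 E x y z zs)
  then have "non_backtracking E (rev zs @ [z, y])" by simp
  moreover have "(y, z) \<in> E" using non_backtracking_arcs[of E "y # z # zs"] 4 by simp
  then have "non_backtracking E [z, y, x]" using 4 by (auto dest: symD)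
  ultimately show ?case using non_backtracking_glue[of E "rev zs" z y "[x]"] by simp
qed auto

text \<open>
  Two walks that leave \<open>r\<close> in different directions combine to a walk through \<open>r\<close>. Through
  \<open>non_backtracking_distinct\<close>, this is how different arms of a tree are seen to be disjoint.
\<close>

lemma non_backtracking_join:
  assumes "sym E" "non_backtracking E (r # a # as)" "non_backtracking E (r # b # bs)" "a \<noteq> b"
  shows "non_backtracking E (rev (a # as) @ r # b # bs)"
proof -
  have "non_backtracking E (rev as @ [a, r])" using non_backtracking_rev[OF assms(1,2)] by simp
  moreover have "(a, r) \<in> E" using non_backtracking_arcs[OF assms(2)] assms(1) by (auto dest: symD)
  then have "non_backtracking E (a # r # b # bs)" using assms by simp
  ultimately show ?thesis using non_backtracking_glue[of E "rev as" a r "b # bs"] by simp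
qed

lemma rtrancl_distinct_path:
  assumes "(u, w) \<in> R\<^sup>*"
  shows "\<exists>xs. distinct (u # xs) \<and> successively (\<lambda>a b. (a, b) \<in> R) (u # xs) \<and> last (u # xs) = w"
  using assms
proof (induction rule: converse_rtrancl_induct)
  case base
  show ?case by (intro exI[of _ "[]"]) simp
next
  case (step u u')
  then obtain xs where xs: "distinct (u' # xs)" "successively (\<lambda>a b. (a, b) \<in> R) (u' # xs)"
    "last (u' # xs) = w" by blast
  show ?case
  proof (cases "u \<in> set (u' # xs)")
    case False
    then show ?thesis using xs step.hyps(1) by (intro exI[of _ "u' # xs"]) auto
  next
    case True
    then obtain as bs where "u' # xs = as @ u # bs" by (meson split_list)
    then show ?thesis using xs by (intro exI[of _ bs]) (auto simp: successively_append_iff)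
  qed
qed

lemma successively_imp_rtrancl:
  "successively (\<lambda>a b. (a, b) \<in> R) xs \<Longrightarrow> xs \<noteq> [] \<Longrightarrow> (hd xs, last xs) \<in> R\<^sup>*"
  by (induction xs rule: induct_list012) (auto intro: converse_rtrancl_into_rtrancl)

section \<open>Trees\<close>

text \<open>
  Trees in terms of vertex lists: a cycle is a list of at least three distinct vertices that returns
  to its first vertex.
\<close>

locale tree_graph = pair_graph +
  assumes nonempty: "pverts G \<noteq> {}"
    and connected: "u \<in> pverts G \<Longrightarrow> w \<in> pverts G \<Longrightarrow> (u, w) \<in> (parcs G)\<^sup>*"
    and acyclic: "distinct (r # xs) \<Longrightarrow> 2 \<le> length xs \<Longrightarrow>
      \<not> successively (\<lambda>u w. (u, w) \<in> parcs G) (r # xs @ [r])"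

lemma undirected_tree_imp_tree_graph:
  fixes G :: "'a pair_pre_digraph"
  assumes "undirected_tree G"
  shows "tree_graph G"
proof -
  interpret pair_graph G using assms by (simp add: undirected_tree_def)
  have conn: "Digraph_Component.connected (with_proj G)"
    and no_cycle: "\<And>p. cycle p \<Longrightarrow> length p < 3"
    using assms by (auto simp: undirected_tree_def not_le)
  have walk: "awalk u (vwalk_arcs (u # xs)) (last (u # xs)) \<and> pawalk_verts u (vwalk_arcs (u # xs)) = u # xs"
    if "u \<in> pverts G" "successively (\<lambda>u w. (u, w) \<in> parcs G) (u # xs)" for u xs
    using that
  proof (induction xs arbitrary: u)
    case (Cons w xs)
    then have "w \<in> pverts G" by (auto dest: in_arcsD2)
    then show ?case using Cons by (auto simp: awalk_Cons_iff)
  qed (simp add: awalk_Nil_iff)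
  show ?thesis
  proof
    show "pverts G \<noteq> {}" using conn by (simp add: connected_conv)
  next
    fix u w assume "u \<in> pverts G" "w \<in> pverts G"
    then have "(u, w) \<in> rtrancl_on (pverts G) ((parcs G)\<^sup>s)" using conn by (simp add: connected_conv)
    then show "(u, w) \<in> (parcs G)\<^sup>*"
    proof (induction rule: rtrancl_on_induct)
      case (step y z)
      then have "(y, z) \<in> parcs G" using arc_sym by (auto simp: symcl_def)
      then show ?case using step by auto
    qed simp
  next
    fix r :: 'a and xs assume d: "distinct (r # xs)" "2 \<le> length xs"
    show "\<not> successively (\<lambda>u w. (u, w) \<in> parcs G) (r # xs @ [r])"
    proof
      assume s: "successively (\<lambda>u w. (u, w) \<in> parcs G) (r # xs @ [r])"
      then have "r \<in> pverts G" using d(2) by (cases xs) (auto dest: in_arcsD1)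
      from walk[OF this s] have "cycle (vwalk_arcs (r # xs @ [r]))"
        using d unfolding cycle_def by (intro exI[of _ r]) auto
      then have "length (vwalk_arcs (r # xs @ [r])) < 3" by (rule no_cycle)
      then have "length (r # xs @ [r]) - 1 < 3"
        by (simp only: vwalk_length_def[symmetric] vwalk_length_simp)
      then show False using d(2) by simp
    qed
  qed
qed

context tree_graph
begin

lemma sym_arcs_rel: "sym (parcs G)"
  by (auto intro: symI simp: arc_sym)

text \<open>
  A shortest segment between two occurrences of a vertex would be a cycle. It has length at least 3,
  as there are no loops and the walk does not turn back.
\<close>

lemma non_backtracking_distinct:
  "non_backtracking (parcs G) xs \<Longrightarrow> distinct xs"
proof (induction "parcs G" xs rule: non_backtracking.induct)
  case (3 x y)
  then show ?case by auto
next
  case (4 x y z zs)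
  then have d: "distinct (y # z # zs)" by simp
  have "x \<notin> set zs"
  proof
    assume "x \<in> set zs"
    then obtain as bs where zs: "zs = as @ x # bs" "x \<notin> set as" by (meson split_list_first)
    have "successively (\<lambda>u w. (u, w) \<in> parcs G) (x # y # z # zs)"
      using non_backtracking_successively[OF "4.prems"] .
    then have "successively (\<lambda>u w. (u, w) \<in> parcs G) ((x # (y # z # as) @ [x]) @ bs)"
      by (simp add: zs(1))
    then have "successively (\<lambda>u w. (u, w) \<in> parcs G) (x # (y # z # as) @ [x])"
      unfolding successively_append_iff by blast
    moreover have "distinct (x # y # z # as)" using d zs 4 by auto
    ultimately show False using acyclic[of x "y # z # as"] by simp
  qed
  then show ?case using d 4 by auto
qed auto

text \<open>
  A path between two neighbours of \<open>r\<close> that avoids \<open>r\<close> closes up to a cycle through \<open>r\<close>.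
\<close>

lemma nbrs_separated:
  assumes "(r, u) \<in> parcs G" "(r, w) \<in> parcs G" "r \<in> S" "(u, w) \<in> (Restr (parcs G) (pverts G - S))\<^sup>*"
  shows "u = w"
proof (rule ccontr)
  assume "u \<noteq> w"
  let ?R = "Restr (parcs G) (pverts G - S)"
  obtain xs where xs: "distinct (u # xs)" "successively (\<lambda>a b. (a, b) \<in> ?R) (u # xs)"
    "last (u # xs) = w" using rtrancl_distinct_path[OF assms(4)] by blast
  have "xs \<noteq> []" using xs(3) \<open>u \<noteq> w\<close> by auto
  have "set (u # xs) \<subseteq> - S" using xs(2) \<open>xs \<noteq> []\<close>
  proof (induction xs arbitrary: u)
    case (Cons a xs) then show ?case by (cases xs) auto
  qed simp
  then have "distinct (r # u # xs)" using xs(1) assms(3) by auto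
  moreover have "successively (\<lambda>a b. (a, b) \<in> parcs G) (u # xs)"
    using xs(2) by (rule successively_mono) auto
  then have "successively (\<lambda>a b. (a, b) \<in> parcs G) (r # (u # xs) @ [r])"
    using assms(1,2) xs(3) \<open>xs \<noteq> []\<close> arc_sym by (simp add: successively_append_iff successively_Cons)
  moreover have "2 \<le> length (u # xs)" using \<open>xs \<noteq> []\<close> by (cases xs) auto
  ultimately show False using acyclic by blast
qed

lemma closed_set_eq_verts:
  assumes "r \<in> S" "S \<subseteq> pverts G" "parcs G `` S \<subseteq> S"
  shows "S = pverts G"
proof -
  have "w \<in> S" if "w \<in> pverts G" for w
  proof -
    have "(r, w) \<in> (parcs G)\<^sup>*" using connected assms that by blast
    then show ?thesis by (induction rule: rtrancl_induct) (use assms in blast)+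
  qed
  then show ?thesis using assms(2) by blast
qed

lemma ex_maximal_non_backtracking:
  assumes "(r, u) \<in> parcs G"
  obtains ws where "non_backtracking (parcs G) (r # u # ws)"
    "\<And>y. \<not> non_backtracking (parcs G) (r # u # ws @ [y])"
proof -
  let ?P = "\<lambda>ws. non_backtracking (parcs G) (r # u # ws)"
  have "?P []" using assms by simp
  moreover have "length ws < Suc (card (pverts G))" if ws: "?P ws" for ws
  proof -
    have "set ws \<subseteq> pverts G"
      using non_backtracking_successively[OF ws]
    proof (induction ws arbitrary: r u)
      case (Cons a ws)
      then show ?case using Cons.IH[of u a] by (auto dest: in_arcsD2)
    qed simp
    moreover have "distinct ws" using non_backtracking_distinct[OF ws] by simp
    ultimately show ?thesis
      using card_mono[OF pair_finite_verts, of "set ws"] distinct_card[of ws] by simp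
  qed
  ultimately obtain ws where "?P ws" "\<And>ws'. ?P ws' \<Longrightarrow> length ws' \<le> length ws"
    using ex_has_greatest_nat[of ?P "[]" length "Suc (card (pverts G))"] by blast
  then show ?thesis using that[of ws] by fastforce
qed

end

section \<open>Pendant paths and the propagation of zeros\<close>

text \<open>
  The list \<open>ws\<close> is a path attached to \<open>r\<close>, given by the neighbourhoods of its vertices; about those
  of \<open>r\<close> nothing is said. This form is suited to propagating zeros of null vectors.
\<close>

fun pendant :: "'a rel \<Rightarrow> 'a \<Rightarrow> 'a list \<Rightarrow> bool" where
  "pendant E r [] \<longleftrightarrow> True"
| "pendant E r [u] \<longleftrightarrow> E `` {u} = {r}"
| "pendant E r (u # w # ws) \<longleftrightarrow> E `` {u} = {r, w} \<and> r \<noteq> w \<and> pendant E u (w # ws)"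

lemma pendant_arcs:
  "pendant E r ws \<Longrightarrow> w \<in> set ws \<Longrightarrow> (w, z) \<in> E \<Longrightarrow>
   (w, z) \<in> set (vwalk_arcs (r # ws)) \<union> (set (vwalk_arcs (r # ws)))\<inverse>"
  by (induction E r ws rule: pendant.induct) auto

lemma pendant_last: "pendant E r ws \<Longrightarrow> ws \<noteq> [] \<Longrightarrow> \<exists>p. E `` {last ws} = {p}"
  by (induction E r ws rule: pendant.induct) auto

lemma set_vwalk_arcs_subset: "set (vwalk_arcs xs) \<subseteq> set xs \<times> set xs"
  by (induction xs rule: vwalk_arcs.induct) auto

lemma pendantI:
  assumes "distinct (r # ws)" "E = set (vwalk_arcs (r # ws)) \<union> (set (vwalk_arcs (r # ws)))\<inverse> \<union> F"
    and "F \<inter> (set ws \<times> UNIV \<union> UNIV \<times> set ws) = {}"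
  shows "pendant E r ws"
  using assms
proof (induction ws arbitrary: r F)
  case (Cons u ws)
  show ?case
  proof (cases ws)
    case Nil
    then show ?thesis using Cons.prems by auto
  next
    case (Cons w ws')
    have "pendant E u (w # ws')"
      unfolding Cons[symmetric]
      by (rule Cons.IH[where F = "{(r, u), (u, r)} \<union> F"])
        (use Cons.prems \<open>ws = w # ws'\<close> in auto)
    moreover have "E `` {u} = {r, w}"
      using Cons.prems \<open>ws = w # ws'\<close> set_vwalk_arcs_subset[of "w # ws'"] by auto
    moreover have "r \<noteq> w" using Cons.prems \<open>ws = w # ws'\<close> by auto
    ultimately show ?thesis by (simp add: Cons)
  qed
qed simp

text \<open>
  A walk through vertices of degree at most 2 that cannot be prolonged uses up all neighbours of
  its vertices.
\<close>

lemma (in tree_graph) pendant_of_maximal: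
  assumes "non_backtracking (parcs G) (r # u # ws)"
    and "\<And>y. \<not> non_backtracking (parcs G) (r # u # ws @ [y])"
    and "\<And>w. w \<in> set (u # ws) \<Longrightarrow> card (parcs G `` {w}) \<le> 2"
  shows "pendant (parcs G) r (u # ws)"
  using assms
proof (induction ws arbitrary: r u)
  case Nil
  then show ?case using arc_sym by fastforce
next
  case (Cons w ws)
  then have arcs: "(r, u) \<in> parcs G" "(u, w) \<in> parcs G" "r \<noteq> w"
    using non_backtracking_arcs[of "parcs G" "r # u # w # ws"] by auto
  have "pendant (parcs G) u (w # ws)"
    using Cons.prems by (intro Cons.IH) (auto simp del: non_backtracking.simps(1-3))
  moreover have "{r, w} = parcs G `` {u}"
    using arcs arc_sym Cons.prems(3)[of u] by (intro card_seteq) auto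
  ultimately show ?case using arcs by simp
qed

context pair_graph
begin

lemma null_vector_at:
  assumes "x \<in> null_vectors G L" "parcs G `` {u} \<noteq> {}"
  shows "(\<Sum>w\<in>parcs G `` {u}. x w) = (if u \<in> L then x u else 0)"
  using assms by (auto simp: null_vectors_def dest: in_arcsD1)

text \<open>
  At each vertex of the path, the equation expresses the entry of the previous vertex through
  those of the vertex itself and of its successor.
\<close>

lemma zero_forced_inward:
  assumes "x \<in> null_vectors G L"
  shows "pendant (parcs G) r ws \<Longrightarrow> ws \<noteq> [] \<Longrightarrow> x (last ws) = 0 \<Longrightarrow> u \<in> set (r # ws) \<Longrightarrow> x u = 0"
proof (induction "parcs G" r ws arbitrary: u rule: pendant.induct)
  case (2 r a)
  then show ?case using null_vector_at[OF assms, of a] by auto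
next
  case (3 r a w ws)
  have N: "parcs G `` {a} = {r, w}" "r \<noteq> w" and p: "pendant (parcs G) a (w # ws)"
    using "3.prems"(1) by simp_all
  have "x (last (w # ws)) = 0" using "3.prems"(3) by simp
  then have z: "x u = 0" if "u \<in> set (a # w # ws)" for u
    using "3.hyps" p that by blast
  have "x r + x w = (if a \<in> L then x a else 0)"
    using null_vector_at[OF assms, of a] N by simp
  then have "x r = 0" using z[of a] z[of w] by (simp split: if_splits)
  then show ?case using z "3.prems"(4) by (cases "u = r") simp_all
qed simp

lemma zero_forced_outward:
  assumes "x \<in> null_vectors G L"
  shows "pendant (parcs G) r ws \<Longrightarrow> x r = 0 \<Longrightarrow> ws \<noteq> [] \<Longrightarrow> x (hd ws) = 0 \<Longrightarrow> u \<in> set ws \<Longrightarrow> x u = 0"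
proof (induction "parcs G" r ws arbitrary: u rule: pendant.induct)
  case (3 r a w ws)
  have N: "parcs G `` {a} = {r, w}" "r \<noteq> w" and p: "pendant (parcs G) a (w # ws)"
    using "3.prems"(1) by simp_all
  have xr: "x r = 0" and xa: "x a = 0" using "3.prems"(2,4) by simp_all
  have "x r + x w = (if a \<in> L then x a else 0)"
    using null_vector_at[OF assms, of a] N by simp
  then have xw: "x w = 0" using xa xr by (simp split: if_splits)
  show ?case
  proof (cases "u = a")
    case False
    then have "u \<in> set (w # ws)" using "3.prems"(5) by simp
    moreover have "x (hd (w # ws)) = 0" using xw by simp
    ultimately show ?thesis using "3.hyps" p xa by blast
  qed (simp add: xa)
qed simp_all

text \<open>
  The assumption says that restricting null vectors to \<open>Z\<close> is injective.
\<close>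

lemma card_null_vectors_le_zero_forcing:
  assumes "finite Z" "\<And>x. x \<in> null_vectors G L \<Longrightarrow> (\<And>u. u \<in> Z \<Longrightarrow> x u = 0) \<Longrightarrow> x = (\<lambda>_. 0)"
  shows "card (null_vectors G L) \<le> 2 ^ card Z"
proof -
  let ?T = "{x :: 'a \<Rightarrow> bit. \<forall>u. u \<notin> Z \<longrightarrow> x u = 0}"
  have "card (null_vectors G L) \<le> card ?T * card {\<lambda>_::'a. 0::bit}"
  proof (rule card_le_fibres[where \<phi> = "\<lambda>x u. if u \<in> Z then x u else 0"])
    fix x y assume xy: "x \<in> null_vectors G L" "y \<in> null_vectors G L"
      and eq: "(\<lambda>u. if u \<in> Z then x u else 0) = (\<lambda>u. if u \<in> Z then y u else 0)"
    have "x u + y u = 0" if "u \<in> Z" for u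
      using fun_cong[OF eq, of u] that by (simp add: bit_add_eq_0_iff)
    then show "(\<lambda>u. x u + y u) \<in> {\<lambda>_. 0}"
      using assms(2)[OF add_in_null_vectors[OF xy]] by simp
  qed (use card_bit_functions[OF assms(1)] in auto)
  then show ?thesis using card_bit_functions(1)[OF assms(1)] by simp
qed

end

section \<open>Large null spaces by deletion of vertices\<close>

lemma of_nat_bit: "of_nat n = (if even n then 0 else 1 :: bit)"
  by (induction n) (auto simp: bit_add_self)

text \<open>
  The vertices \<open>U\<close> represent different components of \<open>G - S\<close>. A vector that is constant on
  components and zero on \<open>S\<close> solves the equation at a vertex \<open>w\<close> outside \<open>S\<close> if there is a loop at
  \<open>w\<close> exactly when \<open>w\<close> has an odd number of neighbours outside \<open>S\<close>. There are \<open>2 ^ |U|\<close> such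
  vectors supported on the components of \<open>U\<close>. Among those with the same left-hand sides at \<open>S\<close>, any
  two differ by a null vector.
\<close>

lemma (in pair_graph) ex_large_null_space:
  assumes U: "U \<subseteq> pverts G - S" and S: "S \<subseteq> pverts G"
    and sep: "\<And>u w. u \<in> U \<Longrightarrow> w \<in> U \<Longrightarrow> (u, w) \<in> (Restr (parcs G) (pverts G - S))\<^sup>* \<Longrightarrow> u = w"
  shows "\<exists>L\<subseteq>pverts G. 2 ^ card U \<le> 2 ^ card S * card (null_vectors G L)"
proof -
  let ?R = "Restr (parcs G) (pverts G - S)"
  define cls where "cls w = {u \<in> U. (u, w) \<in> ?R\<^sup>*}" for w
  define y where "y c w = (\<Sum>u\<in>cls w. c u)" for c :: "'a \<Rightarrow> bit" and w
  \<comment> \<open>\<open>y c\<close> spreads the value \<open>c u\<close> over the component of \<open>u\<close>. Writing it as a sum over \<open>cls w\<close>, which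
    has at most one element, makes it visibly additive in \<open>c\<close>.\<close>
  define L where "L = {w \<in> pverts G - S. odd (card (parcs G `` {w} - S))}"
  have finS: "finite S" and finU: "finite U"
    using S U pair_finite_verts by (auto intro: finite_subset)
  have cls_U: "cls u = {u}" if "u \<in> U" for u
    using that sep by (auto simp: cls_def)
  have cls_out: "cls w = {}" if "w \<notin> pverts G - S" for w
  proof -
    have False if "u \<in> U" "(u, w) \<in> ?R\<^sup>*" for u
      using that(2) that(1) \<open>w \<notin> pverts G - S\<close> U by (cases rule: rtranclE) auto
    then show ?thesis by (auto simp: cls_def)
  qed
  have cls_eq: "cls w = cls w'" if "(w, w') \<in> ?R" for w w'
  proof -
    have "(w', w) \<in> ?R" using that arc_sym by auto
    then show ?thesis using that by (auto simp: cls_def intro: rtrancl_into_rtrancl)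
  qed
  have y_add: "y (\<lambda>u. c u + d u) = (\<lambda>w. y c w + y d w)" for c d
    by (simp add: y_def fun_eq_iff sum.distrib)
  have inner: "(\<Sum>z\<in>parcs G `` {w}. y c z) = (if w \<in> L then y c w else 0)" if w: "w \<in> pverts G - S" for w c
  proof -
    have "(\<Sum>z\<in>parcs G `` {w}. y c z) = (\<Sum>z\<in>parcs G `` {w} - S. y c z)"
      using cls_out by (intro sum.mono_neutral_right) (auto simp: y_def)
    also have "\<dots> = (\<Sum>z\<in>parcs G `` {w} - S. y c w)"
    proof (intro sum.cong refl)
      fix z assume "z \<in> parcs G `` {w} - S"
      then have "(w, z) \<in> ?R" using w by (auto dest: in_arcsD2)
      then have "cls w = cls z" by (rule cls_eq)
      then show "y c z = y c w" by (simp add: y_def)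
    qed
    also have "\<dots> = (if w \<in> L then y c w else 0)"
      using w by (simp add: L_def of_nat_bit)
    finally show ?thesis .
  qed
  let ?C = "{c :: 'a \<Rightarrow> bit. \<forall>u. u \<notin> U \<longrightarrow> c u = 0}"
  let ?T = "{c :: 'a \<Rightarrow> bit. \<forall>u. u \<notin> S \<longrightarrow> c u = 0}"
  have "inj_on y ?C"
  proof (rule inj_onI)
    fix c d assume cd: "c \<in> ?C" "d \<in> ?C" "y c = y d"
    have "c u = d u" for u
    proof (cases "u \<in> U")
      case True
      then show ?thesis using fun_cong[OF cd(3), of u] by (simp add: y_def cls_U)
    qed (use cd in simp)
    then show "c = d" by blast
  qed
  then have "2 ^ card U = card (y ` ?C)"
    using card_bit_functions(1)[OF finU] by (simp add: card_image)
  also have "\<dots> \<le> card ?T * card (null_vectors G L)"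
  proof (rule card_le_fibres[where \<phi> = "\<lambda>x s. if s \<in> S then \<Sum>z\<in>parcs G `` {s}. x z else 0"])
    show "finite (null_vectors G L)" "finite ?T"
      using finite_null_vectors card_bit_functions(2)[OF finS] by auto
    show "(\<lambda>x s. if s \<in> S then \<Sum>z\<in>parcs G `` {s}. x z else 0) ` y ` ?C \<subseteq> ?T" by auto
  next
    fix x x' assume "x \<in> y ` ?C" "x' \<in> y ` ?C"
      and eq: "(\<lambda>s. if s \<in> S then \<Sum>z\<in>parcs G `` {s}. x z else 0)
        = (\<lambda>s. if s \<in> S then \<Sum>z\<in>parcs G `` {s}. x' z else 0)"
    then obtain c d where cd: "x = y c" "x' = y d" by blast
    have onS: "(\<Sum>z\<in>parcs G `` {s}. x z + x' z) = 0" if "s \<in> S" for s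
      using fun_cong[OF eq, of s] that by (simp add: sum.distrib bit_add_eq_0_iff)
    have offS: "(\<Sum>z\<in>parcs G `` {w}. x z + x' z) = (if w \<in> L then x w + x' w else 0)"
      if "w \<in> pverts G - S" for w
      using inner[OF that, of "\<lambda>u. c u + d u"] by (simp only: y_add cd)
    have "(\<Sum>z\<in>parcs G `` {w}. x z + x' z) = (if w \<in> L then x w + x' w else 0)"
      if "w \<in> pverts G" for w
    proof (cases "w \<in> S")
      case True
      then show ?thesis using onS by (simp add: L_def)
    next
      case False
      then show ?thesis using offS that by blast
    qed
    moreover have "x w + x' w = 0" if "w \<notin> pverts G" for w
      using cls_out[of w] that by (simp add: cd y_def)
    ultimately show "(\<lambda>u. x u + x' u) \<in> null_vectors G L"
      unfolding null_vectors_def by blast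
  qed
  finally have "2 ^ card U \<le> 2 ^ card S * card (null_vectors G L)"
    using card_bit_functions(1)[OF finS] by simp
  moreover have "L \<subseteq> pverts G" by (auto simp: L_def)
  ultimately show ?thesis by blast
qed

context tree_graph
begin

lemma ex_null_space_at_vertex:
  assumes "r \<in> pverts G"
  shows "\<exists>L\<subseteq>pverts G. 2 ^ card (parcs G `` {r}) \<le> 2 * card (null_vectors G L)"
proof -
  have "parcs G `` {r} \<subseteq> pverts G - {r}" by (auto dest: in_arcsD2)
  then show ?thesis
    using ex_large_null_space[of "parcs G `` {r}" "{r}"] nbrs_separated[of r _ _ "{r}"] assms by auto
qed

text \<open>
  Let \<open>u\<close> and \<open>w\<close> be the second and the last but one vertex of the path from \<open>r\<close> to \<open>s\<close>. Deleting
  \<open>r\<close> and \<open>s\<close> leaves at least five components: that of \<open>u\<close> and \<open>w\<close>, two more at \<open>r\<close>, and two more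
  at \<open>s\<close>.
\<close>

lemma ex_null_space_at_two_vertices:
  assumes rs: "r \<in> pverts G" "s \<in> pverts G" "r \<noteq> s" "(r, s) \<notin> parcs G"
    and deg: "card (parcs G `` {r}) \<ge> 3" "card (parcs G `` {s}) \<ge> 3"
  shows "\<exists>L\<subseteq>pverts G. 8 \<le> card (null_vectors G L)"
proof -
  let ?R = "Restr (parcs G) (pverts G - {r, s})"
  obtain xs where xs: "distinct (r # xs)" "successively (\<lambda>a b. (a, b) \<in> parcs G) (r # xs)"
    "last (r # xs) = s" using rtrancl_distinct_path[OF connected[OF rs(1,2)]] by blast
  have "xs \<noteq> []" using xs(3) rs(3) by auto
  then obtain ys where ys: "xs = ys @ [s]" using xs(3) by (metis append_butlast_last_id last_ConsR)
  have "ys \<noteq> []" using xs(2) rs(4) ys by auto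
  define u where "u = hd ys"
  define w where "w = last ys"
  have succ: "successively (\<lambda>a b. (a, b) \<in> parcs G) ys" and ru: "(r, u) \<in> parcs G" and "(w, s) \<in> parcs G"
    using xs(2) \<open>ys \<noteq> []\<close> by (auto simp: ys u_def w_def successively_Cons successively_append_iff)
  then have sw: "(s, w) \<in> parcs G" using arc_sym by blast
  have notin: "r \<notin> set ys" "s \<notin> set ys" using xs(1) ys by auto
  have "successively (\<lambda>a b. (a, b) \<in> ?R) ys"
    using succ notin
  proof (induction ys rule: induct_list012)
    case (3 a b zs)
    then show ?case by (auto dest: in_arcsD1 in_arcsD2)
  qed auto
  from successively_imp_rtrancl[OF this \<open>ys \<noteq> []\<close>] have uw: "(u, w) \<in> ?R\<^sup>*"
    by (simp add: u_def w_def)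
  have symR: "sym (?R\<^sup>*)" by (intro sym_rtrancl symI) (auto simp: arc_sym)
  have u: "u \<in> set ys" and w: "w \<in> set ys" using \<open>ys \<noteq> []\<close> by (auto simp: u_def w_def)
  have "2 \<le> card (parcs G `` {r} - {u})" using deg ru by simp
  then obtain A where A: "A \<subseteq> parcs G `` {r} - {u}" "card A = 2" "finite A"
    by (rule obtain_subset_with_card_n)
  have "2 \<le> card (parcs G `` {s} - {w})" using deg sw by simp
  then obtain B where B: "B \<subseteq> parcs G `` {s} - {w}" "card B = 2" "finite B"
    by (rule obtain_subset_with_card_n)
  have fin: "finite A" "finite B" using A(3) B(3) by blast+
  have sep_r: "a = a'" if "(r, a) \<in> parcs G" "(r, a') \<in> parcs G" "(a, a') \<in> ?R\<^sup>*" for a a'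
    using nbrs_separated[OF that(1,2) _ that(3)] by simp
  have sep_s: "b = b'" if "(s, b) \<in> parcs G" "(s, b') \<in> parcs G" "(b, b') \<in> ?R\<^sup>*" for b b'
    using nbrs_separated[OF that(1,2) _ that(3)] by simp
  \<comment> \<open>A path from \<open>a\<close> to \<open>b\<close> could be continued through \<open>s\<close> and \<open>w\<close> to \<open>u\<close>, avoiding \<open>r\<close>.\<close>
  have AB: "(a, b) \<notin> ?R\<^sup>*" if "a \<in> A" "b \<in> B" for a b
  proof
    assume ab: "(a, b) \<in> ?R\<^sup>*"
    let ?Q = "Restr (parcs G) (pverts G - {r})"
    have mono: "?R\<^sup>* \<subseteq> ?Q\<^sup>*" by (intro rtrancl_mono) auto
    have "(a, b) \<in> ?Q\<^sup>*" using ab mono by blast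
    also have "(b, s) \<in> ?Q" using B(1) \<open>b \<in> B\<close> rs arc_sym by (auto dest: in_arcsD2)
    also have "(s, w) \<in> ?Q" using sw w notin rs by (auto dest: in_arcsD2)
    also have "(w, u) \<in> ?Q\<^sup>*" using symD[OF symR uw] mono by blast
    finally have "a = u" using nbrs_separated[of r a u "{r}"] A(1) \<open>a \<in> A\<close> ru by auto
    then show False using A(1) \<open>a \<in> A\<close> by auto
  qed
  have Au: "(a, u) \<notin> ?R\<^sup>*" if "a \<in> A" for a
    using sep_r[of a u] that A(1) ru by auto
  have Bu: "(b, u) \<notin> ?R\<^sup>*" if "b \<in> B" for b
    using sep_s[of b w] that B(1) sw uw by (auto dest: rtrancl_trans)
  let ?U = "insert u (A \<union> B)"
  have "A \<inter> B = {}" using AB by blast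
  moreover have "u \<notin> A \<union> B" using A B Au Bu by blast
  ultimately have "card ?U = 5" using A(2) B(2) fin by (simp add: card_Un_disjoint)
  moreover have "\<exists>L\<subseteq>pverts G. 2 ^ card ?U \<le> 2 ^ card {r, s} * card (null_vectors G L)"
  proof (rule ex_large_null_space)
    have "s \<notin> A" "r \<notin> B" using A(1) B(1) rs(4) arc_sym by auto
    then show "?U \<subseteq> pverts G - {r, s}"
      using A(1) B(1) u notin ru by (auto dest: in_arcsD2)
    show "{r, s} \<subseteq> pverts G" using rs by simp
  next
    fix a b assume "a \<in> ?U" "b \<in> ?U" and ab: "(a, b) \<in> ?R\<^sup>*"
    then consider "a = u" "b = u" | "a = u" "b \<in> A" | "a = u" "b \<in> B" | "a \<in> A" "b = u"
      | "a \<in> A" "b \<in> A" | "a \<in> A" "b \<in> B" | "a \<in> B" "b = u" | "a \<in> B" "b \<in> A" | "a \<in> B" "b \<in> B"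
      by blast
    then show "a = b"
    proof cases
      case 5
      then show ?thesis using sep_r[OF _ _ ab] A(1) by auto
    next
      case 9
      then show ?thesis using sep_s[OF _ _ ab] B(1) by auto
    qed (use ab symD[OF symR ab] Au Bu AB in blast)+
  qed
  ultimately show ?thesis using rs(3) by simp
qed

end

section \<open>Graphs glued from paths\<close>

text \<open>
  The vertices \<open>vs\<close> are listed separately from the paths \<open>Ws\<close>, so that \<open>distinct vs\<close> can say that the
  paths share only the intended vertices. In this form an isomorphism is simply a way to relabel
  the lists.
\<close>

definition glued :: "'a pair_pre_digraph \<Rightarrow> 'a list \<Rightarrow> 'a list list \<Rightarrow> bool" where
  "glued G vs Ws \<longleftrightarrow> distinct vs \<and> pverts G = set vs \<and> (\<forall>W\<in>set Ws. set W \<subseteq> set vs) \<and>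
     parcs G = (let E = \<Union>W\<in>set Ws. set (vwalk_arcs W) in E \<union> E\<inverse>)"

lemma vwalk_arcs_map: "vwalk_arcs (map g xs) = map (map_prod g g) (vwalk_arcs xs)"
  by (induction xs rule: vwalk_arcs.induct) auto

lemma glued_map_iff:
  assumes H: "glued H vs Ws"
  shows "glued G (map g vs) (map (map g) Ws) \<longleftrightarrow>
    inj_on g (pverts H) \<and> pverts G = g ` pverts H \<and> parcs G = map_prod g g ` parcs H"
proof -
  let ?E = "\<Union>W\<in>set Ws. set (vwalk_arcs W)"
  have "(\<Union>W\<in>set (map (map g) Ws). set (vwalk_arcs W)) = map_prod g g ` ?E"
    by (auto simp: vwalk_arcs_map)
  moreover have "map_prod g g ` (?E \<union> ?E\<inverse>) = map_prod g g ` ?E \<union> (map_prod g g ` ?E)\<inverse>"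
    by (auto simp: image_iff) (force+)?
  ultimately show ?thesis
    using H unfolding glued_def Let_def by (auto simp: distinct_map intro!: imageI)
qed

lemma glued_imp_pair_wf_digraph:
  assumes "glued G vs Ws" shows "pair_wf_digraph G"
proof
  fix e assume "e \<in> parcs G"
  then obtain W where "W \<in> set Ws" "e \<in> set (vwalk_arcs W) \<union> (set (vwalk_arcs W))\<inverse>"
    using assms unfolding glued_def Let_def by blast
  moreover have "set W \<subseteq> pverts G" using assms \<open>W \<in> set Ws\<close> unfolding glued_def by blast
  ultimately show "fst e \<in> pverts G" "snd e \<in> pverts G"
    using set_vwalk_arcs_subset[of W] by (cases e; auto)+
qed

text \<open>
  Arcs are pairs of vertices, so an isomorphism is determined by its action on vertices.
\<close>

lemma digraph_iso_with_proj_iff: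
  assumes "pair_wf_digraph H"
  shows "digraph_iso (with_proj H) (with_proj G) \<longleftrightarrow>
    (\<exists>g. inj_on g (pverts H) \<and> pverts G = g ` pverts H \<and> parcs G = map_prod g g ` parcs H)"
    (is "?iso \<longleftrightarrow> (\<exists>g. ?P g)")
proof -
  interpret pair_wf_digraph H by fact
  show ?thesis
  proof
    assume ?iso
    then obtain f where f: "digraph_isomorphism f" and G: "with_proj G = app_iso f (with_proj H)"
      unfolding digraph_iso_def by blast
    have "tail (with_proj G) = iso_tail f" "head (with_proj G) = iso_head f"
      "verts (with_proj G) = iso_verts f ` pverts H" "arcs (with_proj G) = iso_arcs f ` parcs H"
      unfolding G by simp_all
    then have G': "iso_tail f = fst" "iso_head f = snd" "pverts G = iso_verts f ` pverts H"
      "parcs G = iso_arcs f ` parcs H" by simp_all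
    have "iso_arcs f a = map_prod (iso_verts f) (iso_verts f) a" if "a \<in> parcs H" for a
      using f that unfolding digraph_isomorphism_def G' by (simp add: prod_eq_iff)
    then have "?P (iso_verts f)"
      using f G'(3,4) unfolding digraph_isomorphism_def by (auto simp: image_iff)
    then show "\<exists>g. ?P g" by blast
  next
    assume "\<exists>g. ?P g"
    then obtain g where g: "?P g" ..
    define f where "f = \<lparr>iso_verts = g, iso_arcs = map_prod g g, iso_head = snd, iso_tail = fst\<rparr>"
    have "parcs H \<subseteq> pverts H \<times> pverts H" by (auto dest: in_arcsD1 in_arcsD2)
    then have "inj_on (map_prod g g) (parcs H)"
      using g map_prod_inj_on[of g "pverts H" g "pverts H"] by (blast intro: inj_on_subset)
    then have "digraph_isomorphism f"
      using g wf_digraph unfolding digraph_isomorphism_def by (simp add: f_def)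
    moreover have "with_proj G = app_iso f (with_proj H)"
      using g by (simp add: with_proj_def app_iso_def f_def)
    ultimately show ?iso unfolding digraph_iso_def by blast
  qed
qed

lemma digraph_iso_glued_iff:
  assumes "glued H vs Ws" "pair_wf_digraph G"
  shows "digraph_iso (with_proj G) (with_proj H) \<longleftrightarrow> (\<exists>g. glued G (map g vs) (map (map g) Ws))"
proof -
  have wf: "pair_wf_digraph H" using assms(1) by (rule glued_imp_pair_wf_digraph)
  have "digraph_iso (with_proj G) (with_proj H) \<longleftrightarrow> digraph_iso (with_proj H) (with_proj G)"
    using digraph_iso_swap[of "with_proj G" "with_proj H"] digraph_iso_swap[of "with_proj H" "with_proj G"]
      wf assms(2) by (auto simp: wf_digraph_wp_iff)
  then show ?thesis by (simp add: digraph_iso_with_proj_iff[OF wf] glued_map_iff[OF assms(1)])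
qed

text \<open>
  The vertices of a pendant path of the model trees, without the vertex to which it is attached.
\<close>

definition leg :: "nat \<Rightarrow> nat \<Rightarrow> (nat \<times> nat) list" where
  "leg i l = map (Pair i) [1..<Suc l]"

lemma leg_simps [simp]: "leg i 0 = []" "leg i (Suc l) = leg i l @ [(i, Suc l)]"
  by (simp_all add: leg_def)

lemma leg_props [simp]: "set (leg i l) = {i} \<times> {1..l}" "distinct (leg i l)" "length (leg i l) = l"
  by (auto simp: leg_def distinct_map inj_on_def)

lemma arm_image: "arm r i l = (\<lambda>j. (if j = 0 then r else (i, j), (i, Suc j))) ` {..<l}"
  unfolding arm_def lessThan_def image_Collect by (rule refl)

lemma vwalk_arcs_leg: "set (vwalk_arcs (r # leg i l)) = arm r i l"
proof (induction l)
  case 0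
  show ?case by (simp add: arm_def)
next
  case (Suc l)
  have "last (r # leg i l) = (if l = 0 then r else (i, l))" by (cases l) auto
  moreover have "arm r i (Suc l) = insert (if l = 0 then r else (i, l), (i, Suc l)) (arm r i l)"
    by (simp add: arm_image lessThan_Suc)
  ultimately show ?case
    using Suc set_vwalk_arcs_snoc[of "r # leg i l" "(i, Suc l)"] by simp
qed

lemma map_leg:
  assumes "length ws = l" "\<And>j. j < l \<Longrightarrow> g (i, Suc j) = ws ! j"
  shows "map g (leg i l) = ws"
  using assms by (intro nth_equalityI) (auto simp: leg_def nth_append simp del: upt_Suc)

lemma glued_T_tree:
  "glued (T_tree a b c) ((0, 0) # leg 1 a @ leg 2 b @ leg 3 c)
     [(0, 0) # leg 1 a, (0, 0) # leg 2 b, (0, 0) # leg 3 c]"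
  unfolding glued_def T_tree_def Let_def by (auto simp: vwalk_arcs_leg simp del: vwalk_arcs_Cons)

lemma glued_H_tree:
  "glued (H_tree a b c d) ((0, 0) # (0, 1) # leg 1 a @ leg 2 b @ leg 3 c @ leg 4 d)
     [[(0, 0), (0, 1)], (0, 0) # leg 1 a, (0, 0) # leg 2 b, (0, 1) # leg 3 c, (0, 1) # leg 4 d]"
  unfolding glued_def H_tree_def Let_def by (auto simp: vwalk_arcs_leg simp del: vwalk_arcs_Cons)

definition T_decomposition :: "'a pair_pre_digraph \<Rightarrow> 'a \<Rightarrow> 'a list \<Rightarrow> 'a list \<Rightarrow> 'a list \<Rightarrow> bool" where
  "T_decomposition G r as bs cs \<longleftrightarrow> as \<noteq> [] \<and> bs \<noteq> [] \<and> cs \<noteq> [] \<and>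
     glued G (r # as @ bs @ cs) [r # as, r # bs, r # cs]"

definition H_decomposition ::
    "'a pair_pre_digraph \<Rightarrow> 'a \<Rightarrow> 'a \<Rightarrow> 'a list \<Rightarrow> 'a list \<Rightarrow> 'a list \<Rightarrow> 'a list \<Rightarrow> bool" where
  "H_decomposition G r s as bs cs ds \<longleftrightarrow> as \<noteq> [] \<and> bs \<noteq> [] \<and> cs \<noteq> [] \<and> ds \<noteq> [] \<and>
     glued G (r # s # as @ bs @ cs @ ds) [[r, s], r # as, r # bs, s # cs, s # ds]"

lemma T_shape_tree_iff:
  assumes "pair_wf_digraph G"
  shows "T_shape_tree G \<longleftrightarrow> (\<exists>r as bs cs. T_decomposition G r as bs cs)"
proof
  assume "T_shape_tree G"
  then obtain a b c where pos: "a > 0" "b > 0" "c > 0"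
    and "digraph_iso (with_proj G) (with_proj (T_tree a b c))"
    unfolding T_shape_tree_def by blast
  then obtain g where "glued G (map g ((0, 0) # leg 1 a @ leg 2 b @ leg 3 c))
     (map (map g) [(0, 0) # leg 1 a, (0, 0) # leg 2 b, (0, 0) # leg 3 c])"
    using digraph_iso_glued_iff[OF glued_T_tree assms] by blast
  moreover have "leg i l \<noteq> []" if "l > 0" for i l using that by (cases l) simp_all
  ultimately have "T_decomposition G (g (0, 0)) (map g (leg 1 a)) (map g (leg 2 b)) (map g (leg 3 c))"
    unfolding T_decomposition_def using pos by simp
  then show "\<exists>r as bs cs. T_decomposition G r as bs cs" by blast
next
  assume "\<exists>r as bs cs. T_decomposition G r as bs cs"
  then obtain r as bs cs where d: "T_decomposition G r as bs cs" by blast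
  \<comment> \<open>The vertices of a leg are numbered from 1, list positions from 0.\<close>
  define g :: "nat \<times> nat \<Rightarrow> 'a" where
    "g = (\<lambda>(i, j). if i = 0 then r else (if i = 1 then as else if i = 2 then bs else cs) ! (j - 1))"
  have g: "g (0, 0) = r" "map g (leg 1 (length as)) = as" "map g (leg 2 (length bs)) = bs"
    "map g (leg 3 (length cs)) = cs"
    by (auto simp: g_def intro!: map_leg)
  then have "digraph_iso (with_proj G) (with_proj (T_tree (length as) (length bs) (length cs)))"
    unfolding digraph_iso_glued_iff[OF glued_T_tree assms]
    using d unfolding T_decomposition_def by (intro exI[of _ g]) simp
  then show "T_shape_tree G"
    using d unfolding T_shape_tree_def T_decomposition_def by blast
qed

lemma H_shape_tree_iff:
  assumes "pair_wf_digraph G"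
  shows "H_shape_tree G \<longleftrightarrow> (\<exists>r s as bs cs ds. H_decomposition G r s as bs cs ds)"
proof
  assume "H_shape_tree G"
  then obtain a b c d where pos: "a > 0" "b > 0" "c > 0" "d > 0"
    and "digraph_iso (with_proj G) (with_proj (H_tree a b c d))"
    unfolding H_shape_tree_def by blast
  then obtain g where "glued G (map g ((0, 0) # (0, 1) # leg 1 a @ leg 2 b @ leg 3 c @ leg 4 d))
     (map (map g) [[(0, 0), (0, 1)], (0, 0) # leg 1 a, (0, 0) # leg 2 b, (0, 1) # leg 3 c,
       (0, 1) # leg 4 d])"
    using digraph_iso_glued_iff[OF glued_H_tree assms] by blast
  moreover have "leg i l \<noteq> []" if "l > 0" for i l using that by (cases l) simp_all
  ultimately have "H_decomposition G (g (0, 0)) (g (0, 1))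
      (map g (leg 1 a)) (map g (leg 2 b)) (map g (leg 3 c)) (map g (leg 4 d))"
    unfolding H_decomposition_def using pos by simp
  then show "\<exists>r s as bs cs ds. H_decomposition G r s as bs cs ds" by blast
next
  assume "\<exists>r s as bs cs ds. H_decomposition G r s as bs cs ds"
  then obtain r s as bs cs ds where d: "H_decomposition G r s as bs cs ds" by blast
  define g :: "nat \<times> nat \<Rightarrow> 'a" where
    "g = (\<lambda>(i, j). if i = 0 then (if j = 0 then r else s)
       else (if i = 1 then as else if i = 2 then bs else if i = 3 then cs else ds) ! (j - 1))"
  have g: "g (0, 0) = r" "g (0, 1) = s" "map g (leg 1 (length as)) = as"
    "map g (leg 2 (length bs)) = bs" "map g (leg 3 (length cs)) = cs" "map g (leg 4 (length ds)) = ds"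
    by (auto simp: g_def intro!: map_leg)
  then have "digraph_iso (with_proj G)
      (with_proj (H_tree (length as) (length bs) (length cs) (length ds)))"
    unfolding digraph_iso_glued_iff[OF glued_H_tree assms]
    using d unfolding H_decomposition_def by (intro exI[of _ g]) simp
  then show "H_shape_tree G"
    using d unfolding H_shape_tree_def H_decomposition_def by blast
qed

section \<open>Null vectors of T-shape and H-shape trees\<close>

lemma glued_pendant:
  assumes G: "glued G vs Ws" and W: "r # ws \<in> set Ws" "distinct (r # ws)"
    and other: "\<And>W. W \<in> set Ws \<Longrightarrow> W = r # ws \<or> set W \<inter> set ws = {}"
  shows "pendant (parcs G) r ws"
proof (rule pendantI[OF W(2)])
  let ?D = "\<Union>W\<in>set Ws - {r # ws}. set (vwalk_arcs W)"
  have "(\<Union>W\<in>set Ws. set (vwalk_arcs W)) = set (vwalk_arcs (r # ws)) \<union> ?D"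
    using W(1) by blast
  then show "parcs G = set (vwalk_arcs (r # ws)) \<union> (set (vwalk_arcs (r # ws)))\<inverse> \<union> (?D \<union> ?D\<inverse>)"
    using G unfolding glued_def Let_def by (simp add: converse_Un Un_ac)
  have "set (vwalk_arcs W) \<inter> (set ws \<times> UNIV \<union> UNIV \<times> set ws) = {}" if "W \<in> set Ws - {r # ws}" for W
    using other[of W] that set_vwalk_arcs_subset[of W] by auto
  then show "(?D \<union> ?D\<inverse>) \<inter> (set ws \<times> UNIV \<union> UNIV \<times> set ws) = {}" by blast
qed

lemma glued_nbrs:
  assumes "glued G vs Ws"
  shows "parcs G `` {r} = {z. \<exists>W\<in>set Ws. (r, z) \<in> set (vwalk_arcs W) \<or> (z, r) \<in> set (vwalk_arcs W)}"
  using assms unfolding glued_def Let_def by auto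

lemma vwalk_arcs_at_hd:
  assumes "distinct (r # ws)" "ws \<noteq> []"
  shows "(r, z) \<in> set (vwalk_arcs (r # ws)) \<longleftrightarrow> z = hd ws" "(z, r) \<notin> set (vwalk_arcs (r # ws))"
  using assms set_vwalk_arcs_subset[of ws] by auto

lemma vwalk_arcs_notin:
  assumes "r \<notin> set W"
  shows "(r, z) \<notin> set (vwalk_arcs W)" "(z, r) \<notin> set (vwalk_arcs W)"
  using assms set_vwalk_arcs_subset[of W] by auto

context pair_graph
begin

lemma T_decomposition_structure:
  assumes "T_decomposition G r as bs cs"
  shows "pendant (parcs G) r as" "pendant (parcs G) r bs" "pendant (parcs G) r cs"
    and "parcs G `` {r} = {hd as, hd bs, hd cs}" and "distinct [hd as, hd bs, hd cs]"
proof -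
  have ne: "as \<noteq> []" "bs \<noteq> []" "cs \<noteq> []"
    and gl: "glued G (r # as @ bs @ cs) [r # as, r # bs, r # cs]"
    using assms unfolding T_decomposition_def by auto
  have d: "distinct (r # as @ bs @ cs)" using gl unfolding glued_def by blast
  show "pendant (parcs G) r as" by (rule glued_pendant[OF gl]) (use d in auto)
  show "pendant (parcs G) r bs" by (rule glued_pendant[OF gl]) (use d in auto)
  show "pendant (parcs G) r cs" by (rule glued_pendant[OF gl]) (use d in auto)
  have "distinct (r # as)" "distinct (r # bs)" "distinct (r # cs)" using d by auto
  then show "parcs G `` {r} = {hd as, hd bs, hd cs}"
    unfolding glued_nbrs[OF gl] using ne by (auto simp: vwalk_arcs_at_hd simp del: vwalk_arcs_Cons)
  have "hd as \<in> set as" "hd bs \<in> set bs" "hd cs \<in> set cs" using ne by simp_all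
  then show "distinct [hd as, hd bs, hd cs]" using d by auto
qed

text \<open>
  Zeros at the ends of two arms propagate to the centre, whose equation then yields a zero at the
  first vertex of the third arm.
\<close>

lemma T_decomposition_null_space:
  assumes "T_decomposition G r as bs cs"
  shows "card (null_vectors G L) \<le> 4"
proof -
  note st = T_decomposition_structure[OF assms]
  have ne: "as \<noteq> []" "bs \<noteq> []" "cs \<noteq> []" and V: "pverts G = set (r # as @ bs @ cs)"
    using assms unfolding T_decomposition_def glued_def by blast+
  have "card (null_vectors G L) \<le> 2 ^ card {last as, last bs}"
  proof (rule card_null_vectors_le_zero_forcing)
    fix x assume x: "x \<in> null_vectors G L" and "\<And>u. u \<in> {last as, last bs} \<Longrightarrow> x u = 0"
    then have "x (last as) = 0" "x (last bs) = 0" by blast+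
    then have as: "\<And>u. u \<in> set (r # as) \<Longrightarrow> x u = 0" and bs: "\<And>u. u \<in> set (r # bs) \<Longrightarrow> x u = 0"
      using zero_forced_inward[OF x] st(1,2) ne by blast+
    have hd0: "x (hd as) = 0" "x (hd bs) = 0" "x r = 0"
      using as[of "hd as"] bs[of "hd bs"] as[of r] ne by simp_all
    have "x (hd as) + (x (hd bs) + x (hd cs)) = (if r \<in> L then x r else 0)"
      using null_vector_at[OF x, of r] st(4,5) by simp
    then have "x (hd cs) = 0" by (simp only: hd0 if_cancel add_0)
    then have cs: "\<And>u. u \<in> set cs \<Longrightarrow> x u = 0"
      using zero_forced_outward[OF x st(3) hd0(3) ne(3)] by blast
    have "x u = 0" for u
    proof (cases "u \<in> pverts G")
      case True
      then show ?thesis using as bs cs by (auto simp: V)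
    next
      case False
      then show ?thesis using x unfolding null_vectors_def by blast
    qed
    then show "x = (\<lambda>_. 0)" by blast
  qed simp
  also have "\<dots> \<le> 2 ^ 2" by (intro power_increasing) (simp_all add: card_insert_if)
  finally show ?thesis by simp
qed

lemma H_decomposition_structure:
  assumes "H_decomposition G r s as bs cs ds"
  shows "pendant (parcs G) r as" "pendant (parcs G) r bs" "pendant (parcs G) s cs" "pendant (parcs G) s ds"
    and "parcs G `` {r} = {s, hd as, hd bs}" and "distinct [s, hd as, hd bs]"
    and "parcs G `` {s} = {r, hd cs, hd ds}" and "distinct [r, hd cs, hd ds]"
proof -
  have ne: "as \<noteq> []" "bs \<noteq> []" "cs \<noteq> []" "ds \<noteq> []"
    and gl: "glued G (r # s # as @ bs @ cs @ ds) [[r, s], r # as, r # bs, s # cs, s # ds]"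
    using assms unfolding H_decomposition_def by auto
  have d: "distinct (r # s # as @ bs @ cs @ ds)" using gl unfolding glued_def by blast
  show "pendant (parcs G) r as" by (rule glued_pendant[OF gl]) (use d in auto)
  show "pendant (parcs G) r bs" by (rule glued_pendant[OF gl]) (use d in auto)
  show "pendant (parcs G) s cs" by (rule glued_pendant[OF gl]) (use d in auto)
  show "pendant (parcs G) s ds" by (rule glued_pendant[OF gl]) (use d in auto)
  have dist: "distinct (r # as)" "distinct (r # bs)" "distinct (s # cs)" "distinct (s # ds)"
    and r: "r \<notin> set (s # cs)" "r \<notin> set (s # ds)" and s: "s \<notin> set (r # as)" "s \<notin> set (r # bs)"
    and rs: "r \<noteq> s"
    using d by auto
  show "parcs G `` {r} = {s, hd as, hd bs}"
    unfolding glued_nbrs[OF gl] using ne rs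
    by (auto simp: vwalk_arcs_at_hd[OF dist(1)] vwalk_arcs_at_hd[OF dist(2)]
        vwalk_arcs_notin[OF r(1)] vwalk_arcs_notin[OF r(2)] simp del: vwalk_arcs_Cons)
  show "parcs G `` {s} = {r, hd cs, hd ds}"
    unfolding glued_nbrs[OF gl] using ne rs
    by (auto simp: vwalk_arcs_at_hd[OF dist(3)] vwalk_arcs_at_hd[OF dist(4)]
        vwalk_arcs_notin[OF s(1)] vwalk_arcs_notin[OF s(2)] simp del: vwalk_arcs_Cons)
  have "hd as \<in> set as" "hd bs \<in> set bs" "hd cs \<in> set cs" "hd ds \<in> set ds" using ne by simp_all
  then show "distinct [s, hd as, hd bs]" "distinct [r, hd cs, hd ds]" using d by auto
qed

text \<open>
  The two ends must belong to different branching vertices: each branching vertex then has only one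
  neighbour left at which its equation can force a zero.
\<close>

lemma H_decomposition_null_space:
  assumes "H_decomposition G r s as bs cs ds"
  shows "card (null_vectors G L) \<le> 4"
proof -
  note st = H_decomposition_structure[OF assms]
  have ne: "as \<noteq> []" "bs \<noteq> []" "cs \<noteq> []" "ds \<noteq> []" and V: "pverts G = set (r # s # as @ bs @ cs @ ds)"
    using assms unfolding H_decomposition_def glued_def by blast+
  have "card (null_vectors G L) \<le> 2 ^ card {last as, last cs}"
  proof (rule card_null_vectors_le_zero_forcing)
    fix x assume x: "x \<in> null_vectors G L" and "\<And>u. u \<in> {last as, last cs} \<Longrightarrow> x u = 0"
    then have "x (last as) = 0" "x (last cs) = 0" by blast+
    then have as: "\<And>u. u \<in> set (r # as) \<Longrightarrow> x u = 0" and cs: "\<And>u. u \<in> set (s # cs) \<Longrightarrow> x u = 0"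
      using zero_forced_inward[OF x] st(1,3) ne by blast+
    have hd0: "x (hd as) = 0" "x (hd cs) = 0" "x r = 0" "x s = 0"
      using as[of "hd as"] cs[of "hd cs"] as[of r] cs[of s] ne by simp_all
    have "x s + (x (hd as) + x (hd bs)) = (if r \<in> L then x r else 0)"
      using null_vector_at[OF x, of r] st(5,6) by simp
    then have "x (hd bs) = 0" by (simp only: hd0 if_cancel add_0)
    then have bs: "\<And>u. u \<in> set bs \<Longrightarrow> x u = 0"
      using zero_forced_outward[OF x st(2) hd0(3) ne(2)] by blast
    have "x r + (x (hd cs) + x (hd ds)) = (if s \<in> L then x s else 0)"
      using null_vector_at[OF x, of s] st(7,8) by simp
    then have "x (hd ds) = 0" by (simp only: hd0 if_cancel add_0)
    then have ds: "\<And>u. u \<in> set ds \<Longrightarrow> x u = 0"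
      using zero_forced_outward[OF x st(4) hd0(4) ne(4)] by blast
    have "x u = 0" for u
    proof (cases "u \<in> pverts G")
      case True
      then show ?thesis using as bs cs ds by (auto simp: V)
    next
      case False
      then show ?thesis using x unfolding null_vectors_def by blast
    qed
    then show "x = (\<lambda>_. 0)" by blast
  qed simp
  also have "\<dots> \<le> 2 ^ 2" by (intro power_increasing) (simp_all add: card_insert_if)
  finally show ?thesis by simp
qed

end

section \<open>Decomposing trees of small degree\<close>

context tree_graph
begin

lemma non_backtracking_verts:
  "non_backtracking (parcs G) (r # u # ws) \<Longrightarrow> set (r # u # ws) \<subseteq> pverts G"
proof (induction ws arbitrary: r u)
  case Nil
  then show ?case by (auto dest: in_arcsD1 in_arcsD2)
next
  case (Cons w ws)
  then show ?case using Cons.IH[of u w] by (auto dest: in_arcsD1)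
qed

text \<open>
  The degree bound is required only on the walks that start with \<open>r\<close>, \<open>u\<close>, because the other branches
  at \<open>r\<close> may contain vertices of degree 3.
\<close>

lemma ex_pendant_arm:
  assumes "(r, u) \<in> parcs G"
    and "\<And>ws w. non_backtracking (parcs G) (r # u # ws) \<Longrightarrow> w \<in> set (u # ws) \<Longrightarrow>
      card (parcs G `` {w}) \<le> 2"
  shows "\<exists>ws. non_backtracking (parcs G) (r # u # ws) \<and> pendant (parcs G) r (u # ws)"
proof -
  obtain ws where "non_backtracking (parcs G) (r # u # ws)"
    "\<And>y. \<not> non_backtracking (parcs G) (r # u # ws @ [y])"
    using ex_maximal_non_backtracking[OF assms(1)] by blast
  then show ?thesis using pendant_of_maximal[of r u ws] assms(2) by blast
qed

text \<open>
  By connectedness it suffices that the paths contain all edges at their own vertices.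
\<close>

lemma gluedI:
  assumes vs: "distinct vs" "vs \<noteq> []" "set vs \<subseteq> pverts G"
    and Ws: "\<And>W. W \<in> set Ws \<Longrightarrow> set W \<subseteq> set vs \<and> set (vwalk_arcs W) \<subseteq> parcs G"
    and cover: "\<And>w z. w \<in> set vs \<Longrightarrow> (w, z) \<in> parcs G \<Longrightarrow>
      \<exists>W\<in>set Ws. (w, z) \<in> set (vwalk_arcs W) \<union> (set (vwalk_arcs W))\<inverse>"
  shows "glued G vs Ws"
proof -
  let ?E = "\<Union>W\<in>set Ws. set (vwalk_arcs W)"
  have "parcs G `` set vs \<subseteq> set vs"
  proof
    fix z assume "z \<in> parcs G `` set vs"
    then obtain W where "W \<in> set Ws" "z \<in> set W"
      using cover set_vwalk_arcs_subset by fast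
    then show "z \<in> set vs" using Ws by blast
  qed
  then have V: "set vs = pverts G"
    using vs closed_set_eq_verts[of "hd vs" "set vs"] by simp
  have "parcs G \<subseteq> ?E \<union> ?E\<inverse>"
  proof (rule subrelI)
    fix w z assume wz: "(w, z) \<in> parcs G"
    then have "w \<in> set vs" using V by (auto dest: in_arcsD1)
    then show "(w, z) \<in> ?E \<union> ?E\<inverse>" using cover[OF _ wz] by blast
  qed
  moreover have "?E \<subseteq> parcs G" using Ws by blast
  moreover have "?E\<inverse> \<subseteq> parcs G" using \<open>?E \<subseteq> parcs G\<close> arc_sym by auto
  ultimately show ?thesis unfolding glued_def Let_def using vs(1) V Ws by auto
qed

lemma ex_T_decomposition:
  assumes deg: "card (parcs G `` {r}) = 3"
    and small: "\<And>w. w \<in> pverts G \<Longrightarrow> w \<noteq> r \<Longrightarrow> card (parcs G `` {w}) \<le> 2"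
  shows "\<exists>as bs cs. T_decomposition G r as bs cs"
proof -
  let ?nb = "non_backtracking (parcs G)"
  obtain a b c where N: "parcs G `` {r} = {a, b, c}" and abc: "a \<noteq> b" "a \<noteq> c" "b \<noteq> c"
    using deg by (auto simp: card_3_iff)
  have arm: "\<exists>ws. ?nb (r # u # ws) \<and> pendant (parcs G) r (u # ws)" if "u \<in> {a, b, c}" for u
  proof (rule ex_pendant_arm)
    show "(r, u) \<in> parcs G" using that N by blast
    fix ws w assume nb: "?nb (r # u # ws)" and w: "w \<in> set (u # ws)"
    then show "card (parcs G `` {w}) \<le> 2"
      using small non_backtracking_verts[OF nb] non_backtracking_distinct[OF nb] by auto
  qed
  obtain as where as: "?nb (r # a # as)" "pendant (parcs G) r (a # as)" using arm[of a] by blast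
  obtain bs where bs: "?nb (r # b # bs)" "pendant (parcs G) r (b # bs)" using arm[of b] by blast
  obtain cs where cs: "?nb (r # c # cs)" "pendant (parcs G) r (c # cs)" using arm[of c] by blast
  have "distinct (rev (a # as) @ r # b # bs)" "distinct (rev (a # as) @ r # c # cs)"
    "distinct (rev (b # bs) @ r # c # cs)"
    using non_backtracking_distinct non_backtracking_join[OF sym_arcs_rel] as bs cs abc by blast+
  then have d: "distinct (r # (a # as) @ (b # bs) @ (c # cs))" by auto
  have "glued G (r # (a # as) @ (b # bs) @ (c # cs)) [r # a # as, r # b # bs, r # c # cs]"
  proof (rule gluedI[OF d])
    show "set (r # (a # as) @ (b # bs) @ c # cs) \<subseteq> pverts G"
      using non_backtracking_verts[OF as(1)] non_backtracking_verts[OF bs(1)]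
        non_backtracking_verts[OF cs(1)] by auto
  next
    fix W assume "W \<in> set [r # a # as, r # b # bs, r # c # cs]"
    then consider "W = r # a # as" | "W = r # b # bs" | "W = r # c # cs" by auto
    then show "set W \<subseteq> set (r # (a # as) @ (b # bs) @ c # cs) \<and> set (vwalk_arcs W) \<subseteq> parcs G"
      using non_backtracking_arcs[OF as(1)] non_backtracking_arcs[OF bs(1)]
        non_backtracking_arcs[OF cs(1)] by cases (auto simp del: vwalk_arcs.simps vwalk_arcs_Cons)
  next
    fix w z assume w: "w \<in> set (r # (a # as) @ (b # bs) @ c # cs)" and wz: "(w, z) \<in> parcs G"
    show "\<exists>W\<in>set [r # a # as, r # b # bs, r # c # cs].
        (w, z) \<in> set (vwalk_arcs W) \<union> (set (vwalk_arcs W))\<inverse>"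
    proof (cases "w = r")
      case True
      then have "z \<in> {a, b, c}" using wz N by blast
      then show ?thesis using True by auto
    next
      case False
      then have "w \<in> set (a # as) \<or> w \<in> set (b # bs) \<or> w \<in> set (c # cs)" using w by auto
      then show ?thesis
        using pendant_arcs[OF as(2) _ wz] pendant_arcs[OF bs(2) _ wz] pendant_arcs[OF cs(2) _ wz]
        by (auto simp del: vwalk_arcs.simps vwalk_arcs_Cons)
    qed
  qed simp
  then show ?thesis unfolding T_decomposition_def by blast
qed

text \<open>
  The arms at \<open>r\<close> avoid \<open>s\<close>, because a walk that starts with \<open>s\<close>, \<open>r\<close> and does not turn back never
  returns to \<open>s\<close>.
\<close>

lemma ex_H_decomposition:
  assumes rs: "(r, s) \<in> parcs G" and deg: "card (parcs G `` {r}) = 3" "card (parcs G `` {s}) = 3"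
    and small: "\<And>w. w \<in> pverts G \<Longrightarrow> w \<noteq> r \<Longrightarrow> w \<noteq> s \<Longrightarrow> card (parcs G `` {w}) \<le> 2"
  shows "\<exists>as bs cs ds. H_decomposition G r s as bs cs ds"
proof -
  let ?nb = "non_backtracking (parcs G)"
  have sr: "(s, r) \<in> parcs G" using rs arc_sym by blast
  have other: "\<exists>a b. parcs G `` {p} = {q, a, b} \<and> a \<noteq> b \<and> a \<noteq> q \<and> b \<noteq> q"
    if pq: "(p, q) \<in> parcs G" and "card (parcs G `` {p}) = 3" for p q
  proof -
    have "card (parcs G `` {p} - {q}) = 2" using that by simp
    then obtain a b where ab: "parcs G `` {p} - {q} = {a, b}" "a \<noteq> b" by (auto simp: card_2_iff)
    then have "parcs G `` {p} = {q, a, b}" using pq by blast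
    moreover have "a \<noteq> q" "b \<noteq> q" using ab(1) by blast+
    ultimately show ?thesis using ab(2) by blast
  qed
  obtain a b where Nr: "parcs G `` {r} = {s, a, b}" and ab: "a \<noteq> b" "a \<noteq> s" "b \<noteq> s"
    using other[OF rs deg(1)] by blast
  obtain c d where Ns: "parcs G `` {s} = {r, c, d}" and cd: "c \<noteq> d" "c \<noteq> r" "d \<noteq> r"
    using other[OF sr deg(2)] by blast
  have arm: "\<exists>ws. ?nb (p # u # ws) \<and> pendant (parcs G) p (u # ws)"
    if pq: "(q, p) \<in> parcs G" "{p, q} = {r, s}" and u: "(p, u) \<in> parcs G" "u \<noteq> q" for p q u
  proof (rule ex_pendant_arm[OF u(1)])
    fix ws w assume nb: "?nb (p # u # ws)" and w: "w \<in> set (u # ws)"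
    then have "?nb (q # p # u # ws)" using pq(1) u(2) by simp
    then have "w \<noteq> p" "w \<noteq> q" using non_backtracking_distinct w by fastforce+
    then have "w \<noteq> r" "w \<noteq> s" using pq(2) by blast+
    then show "card (parcs G `` {w}) \<le> 2"
      using small non_backtracking_verts[OF nb] w by auto
  qed
  obtain as where as: "?nb (r # a # as)" "pendant (parcs G) r (a # as)"
    using arm[of s r a] sr Nr ab by blast
  obtain bs where bs: "?nb (r # b # bs)" "pendant (parcs G) r (b # bs)"
    using arm[of s r b] sr Nr ab by blast
  obtain cs where cs: "?nb (s # c # cs)" "pendant (parcs G) s (c # cs)"
    using arm[of r s c] rs Ns cd by blast
  obtain ds where ds: "?nb (s # d # ds)" "pendant (parcs G) s (d # ds)"
    using arm[of r s d] rs Ns cd by blast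
  have cs': "?nb (r # s # c # cs)" and ds': "?nb (r # s # d # ds)"
    using cs(1) ds(1) rs cd by simp_all
  note join = non_backtracking_distinct[OF non_backtracking_join[OF sym_arcs_rel]]
  have "distinct (rev (a # as) @ r # b # bs)" using join[OF as(1) bs(1)] ab by blast
  moreover have "distinct (rev (c # cs) @ s # d # ds)" using join[OF cs(1) ds(1)] cd by blast
  moreover have "distinct (rev (a # as) @ r # s # c # cs)" using join[OF as(1) cs'] ab by blast
  moreover have "distinct (rev (a # as) @ r # s # d # ds)" using join[OF as(1) ds'] ab by blast
  moreover have "distinct (rev (b # bs) @ r # s # c # cs)" using join[OF bs(1) cs'] ab by blast
  moreover have "distinct (rev (b # bs) @ r # s # d # ds)" using join[OF bs(1) ds'] ab by blast
  ultimately have dist: "distinct (r # s # (a # as) @ (b # bs) @ (c # cs) @ (d # ds))" by auto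
  have "glued G (r # s # (a # as) @ (b # bs) @ (c # cs) @ (d # ds))
     [[r, s], r # a # as, r # b # bs, s # c # cs, s # d # ds]" (is "glued G ?vs ?Ws")
  proof (rule gluedI[OF dist])
    show "set ?vs \<subseteq> pverts G"
      using non_backtracking_verts[OF as(1)] non_backtracking_verts[OF bs(1)]
        non_backtracking_verts[OF cs(1)] non_backtracking_verts[OF ds(1)] by auto
  next
    fix W assume "W \<in> set ?Ws"
    then consider "W = [r, s]" | "W = r # a # as" | "W = r # b # bs" | "W = s # c # cs" | "W = s # d # ds"
      by auto
    then show "set W \<subseteq> set ?vs \<and> set (vwalk_arcs W) \<subseteq> parcs G"
    proof cases
      case 1
      then show ?thesis using rs by simp
    qed (use non_backtracking_arcs[OF as(1)] non_backtracking_arcs[OF bs(1)]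
        non_backtracking_arcs[OF cs(1)] non_backtracking_arcs[OF ds(1)]
        in \<open>auto simp del: vwalk_arcs.simps vwalk_arcs_Cons\<close>)
  next
    fix w z assume w: "w \<in> set ?vs" and wz: "(w, z) \<in> parcs G"
    show "\<exists>W\<in>set ?Ws. (w, z) \<in> set (vwalk_arcs W) \<union> (set (vwalk_arcs W))\<inverse>"
    proof -
      consider "w = r" | "w = s" | "w \<in> set (a # as) \<or> w \<in> set (b # bs) \<or> w \<in> set (c # cs) \<or> w \<in> set (d # ds)"
        using w by auto
      then show ?thesis
      proof cases
        case 1
        then have "z \<in> {s, a, b}" using wz Nr by blast
        then show ?thesis using 1 by auto
      next
        case 2
        then have "z \<in> {r, c, d}" using wz Ns by blast
        then show ?thesis using 2 by auto
      next
        case 3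
        then show ?thesis
          using pendant_arcs[OF as(2) _ wz] pendant_arcs[OF bs(2) _ wz] pendant_arcs[OF cs(2) _ wz]
            pendant_arcs[OF ds(2) _ wz]
          by (auto simp del: vwalk_arcs.simps vwalk_arcs_Cons)
      qed
    qed
  qed simp
  then show ?thesis unfolding H_decomposition_def by blast
qed

text \<open>
  Such a tree is a path. The far end \<open>z\<close> of a maximal walk has only one neighbour, so a zero at \<open>z\<close>
  forces a zero there as well, and then along the whole path.
\<close>

lemma null_space_of_max_degree_two:
  assumes small: "\<And>w. w \<in> pverts G \<Longrightarrow> card (parcs G `` {w}) \<le> 2"
  shows "card (null_vectors G L) \<le> 2"
proof -
  have arm: "\<exists>ws. non_backtracking (parcs G) (p # u # ws) \<and> pendant (parcs G) p (u # ws)"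
    if "(p, u) \<in> parcs G" for p u
  proof (rule ex_pendant_arm[OF that])
    fix ws w assume "non_backtracking (parcs G) (p # u # ws)" "w \<in> set (u # ws)"
    then have "w \<in> pverts G" using non_backtracking_verts[of p u ws] by auto
    then show "card (parcs G `` {w}) \<le> 2" by (rule small)
  qed
  obtain r where r: "r \<in> pverts G" using nonempty by blast
  have "\<exists>z. \<forall>x\<in>null_vectors G L. x z = 0 \<longrightarrow> (\<forall>u\<in>pverts G. x u = 0)"
  proof (cases "parcs G `` {r} = {}")
    case True
    then have "{r} = pverts G" using r by (intro closed_set_eq_verts) auto
    then have "pverts G = {r}" by blast
    then show ?thesis by (intro exI[of _ r]) simp
  next
    case False
    then obtain u where "(r, u) \<in> parcs G" by blast
    then obtain ws where "pendant (parcs G) r (u # ws)" using arm by blast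
    then obtain z p where zp: "parcs G `` {z} = {p}" using pendant_last[of "parcs G" r "u # ws"] by blast
    then have "(z, p) \<in> parcs G" by blast
    then obtain ps where ps: "non_backtracking (parcs G) (z # p # ps)" "pendant (parcs G) z (p # ps)"
      using arm by blast
    have closed: "parcs G `` set (z # p # ps) \<subseteq> set (z # p # ps)"
    proof clarify
      fix y w assume "w \<in> set (z # p # ps)" and wy: "(w, y) \<in> parcs G"
      then consider "w = z" | "w \<in> set (p # ps)" by auto
      then show "y \<in> set (z # p # ps)"
      proof cases
        case 1
        then show ?thesis using zp wy by auto
      next
        case 2
        then show ?thesis
          using pendant_arcs[OF ps(2) _ wy] set_vwalk_arcs_subset[of "z # p # ps"] by blast
      qed
    qed
    have V: "set (z # p # ps) = pverts G"
      by (rule closed_set_eq_verts[OF _ non_backtracking_verts[OF ps(1)] closed, of z]) simp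
    have "x u = 0" if x: "x \<in> null_vectors G L" "x z = 0" and u: "u \<in> pverts G" for x u
    proof -
      have "x p = 0" using null_vector_at[OF x(1), of z] zp x(2) by (simp split: if_splits)
      then have "x w = 0" if "w \<in> set (p # ps)" for w
        using zero_forced_outward[OF x(1) ps(2) x(2)] that by simp
      then show ?thesis using u x(2) unfolding V[symmetric] by auto
    qed
    then show ?thesis by blast
  qed
  then obtain z where z: "\<And>x u. x \<in> null_vectors G L \<Longrightarrow> x z = 0 \<Longrightarrow> u \<in> pverts G \<Longrightarrow> x u = 0" by blast
  have "card (null_vectors G L) \<le> 2 ^ card {z}"
  proof (rule card_null_vectors_le_zero_forcing)
    fix x assume x: "x \<in> null_vectors G L" and "\<And>u. u \<in> {z} \<Longrightarrow> x u = 0"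
    then have "x z = 0" by blast
    have "x u = 0" for u
    proof (cases "u \<in> pverts G")
      case True
      then show ?thesis using z[OF x \<open>x z = 0\<close>] by blast
    next
      case False
      then show ?thesis using x unfolding null_vectors_def by blast
    qed
    then show "x = (\<lambda>_. 0)" by blast
  qed simp
  then show ?thesis by simp
qed

section \<open>Trees of maximal corank two\<close>

lemma null_space_dimension_two_iff:
  "(\<forall>L\<subseteq>pverts G. card (null_vectors G L) \<le> 4) \<and> (\<exists>L\<subseteq>pverts G. 4 \<le> card (null_vectors G L)) \<longleftrightarrow>
   (\<exists>r as bs cs. T_decomposition G r as bs cs) \<or> (\<exists>r s as bs cs ds. H_decomposition G r s as bs cs ds)"
  (is "?max \<and> ?ex \<longleftrightarrow> ?T \<or> ?H")
proof
  assume "?max \<and> ?ex"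
  then have max: ?max and ex: ?ex by blast+
  have deg: "card (parcs G `` {r}) \<le> 3" if r: "r \<in> pverts G" for r
  proof -
    obtain L where "L \<subseteq> pverts G" "2 ^ card (parcs G `` {r}) \<le> 2 * card (null_vectors G L)"
      using ex_null_space_at_vertex[OF r] by blast
    moreover have "card (null_vectors G L) \<le> 4" using max \<open>L \<subseteq> pverts G\<close> by blast
    ultimately have "(2::nat) ^ card (parcs G `` {r}) \<le> 2 ^ 3" by simp
    then show ?thesis by (rule power_le_imp_le_exp[rotated]) simp
  qed
  have adj: "(r, s) \<in> parcs G"
    if "r \<in> pverts G" "s \<in> pverts G" "r \<noteq> s" "\<not> card (parcs G `` {r}) \<le> 2" "\<not> card (parcs G `` {s}) \<le> 2" for r s
  proof (rule ccontr)
    assume "(r, s) \<notin> parcs G"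
    then have "\<exists>L\<subseteq>pverts G. 8 \<le> card (null_vectors G L)"
      using that(4,5) by (intro ex_null_space_at_two_vertices[OF that(1-3)]) simp_all
    then obtain L where "L \<subseteq> pverts G" "8 \<le> card (null_vectors G L)" by blast
    moreover have "card (null_vectors G L) \<le> 4" using max \<open>L \<subseteq> pverts G\<close> by blast
    ultimately show False by simp
  qed
  have "\<exists>r\<in>pverts G. \<not> card (parcs G `` {r}) \<le> 2"
  proof (rule ccontr)
    assume "\<not> ?thesis"
    then have "card (null_vectors G L) \<le> 2" for L using null_space_of_max_degree_two by blast
    then show False using ex by (meson le_trans numeral_le_iff semiring_norm(69,71))
  qed
  then obtain r where r: "r \<in> pverts G" "\<not> card (parcs G `` {r}) \<le> 2" by blast
  show "?T \<or> ?H"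
  proof (cases "\<exists>s\<in>pverts G. s \<noteq> r \<and> \<not> card (parcs G `` {s}) \<le> 2")
    case False
    then have "\<exists>as bs cs. T_decomposition G r as bs cs"
      using deg[OF r(1)] r(2) by (intro ex_T_decomposition) auto
    then show ?thesis by blast
  next
    case True
    then obtain s where s: "s \<in> pverts G" "s \<noteq> r" "\<not> card (parcs G `` {s}) \<le> 2" by blast
    \<comment> \<open>A third vertex of degree 3 would form a triangle with \<open>r\<close> and \<open>s\<close>.\<close>
    have "card (parcs G `` {w}) \<le> 2" if w: "w \<in> pverts G" "w \<noteq> r" "w \<noteq> s" for w
    proof (rule ccontr)
      assume "\<not> card (parcs G `` {w}) \<le> 2"
      then have "(r, s) \<in> parcs G" "(s, w) \<in> parcs G" "(w, r) \<in> parcs G" using adj r s w by blast+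
      then have "non_backtracking (parcs G) [r, s, w, r]" using s(2) w by simp
      then show False using non_backtracking_distinct by fastforce
    qed
    moreover have "(r, s) \<in> parcs G" using adj r s by blast
    ultimately have "\<exists>as bs cs ds. H_decomposition G r s as bs cs ds"
      using deg[OF r(1)] deg[OF s(1)] r(2) s(3) by (intro ex_H_decomposition) auto
    then show ?thesis by blast
  qed
next
  assume *: "?T \<or> ?H"
  have "\<exists>r\<in>pverts G. card (parcs G `` {r}) = 3"
    using *
  proof
    assume ?T
    then obtain r as bs cs where d: "T_decomposition G r as bs cs" by blast
    have "card (parcs G `` {r}) = 3" using T_decomposition_structure(4,5)[OF d] by simp
    moreover have "r \<in> pverts G" using d unfolding T_decomposition_def glued_def by simp
    ultimately show ?thesis by blast
  next
    assume ?H
    then obtain r s as bs cs ds where d: "H_decomposition G r s as bs cs ds" by blast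
    have "card (parcs G `` {r}) = 3" using H_decomposition_structure(5,6)[OF d] by simp
    moreover have "r \<in> pverts G" using d unfolding H_decomposition_def glued_def by simp
    ultimately show ?thesis by blast
  qed
  then obtain r where "r \<in> pverts G" "card (parcs G `` {r}) = 3" by blast
  then have ?ex using ex_null_space_at_vertex[of r] by auto
  moreover have ?max using * T_decomposition_null_space H_decomposition_null_space by blast
  ultimately show "?max \<and> ?ex" by blast
qed

end

theorem theorem14:
  fixes T :: "'a pair_pre_digraph" and n :: nat and v :: "nat \<Rightarrow> 'a"
  assumes "undirected_tree T"
    and "card (pverts T) = n"
    and "bij_betw v {..<n} (pverts T)"
  shows "trinomial (partial_petrial_poly T v) \<longleftrightarrow> T_shape_tree T \<or> H_shape_tree T"
proof -
  interpret tree_graph T using assms(1) by (rule undirected_tree_imp_tree_graph)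
  have "pair_wf_digraph T" by unfold_locales
  then show ?thesis
    using trinomial_iff_null_vectors[OF assms(3,2)] null_space_dimension_two_iff
    by (simp only: T_shape_tree_iff H_shape_tree_iff)
qed

end
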